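(* Let $0<\alpha<1$, $h>0$, $n\ge 1$, and let $\chi^0,\dots,\chi^{n-1}\in L^\infty(\Omega;\{0,1\})$ be the previously constructed thresholded states of the fractional Helmholtz-threshold scheme, with L1 history average $\bar\chi^{\,n-1}$. Then the weak solution $w^n\in H^1(\Omega)$ (with periodic boundary conditions) of $$\Big(\frac{1}{\Gamma(2-\alpha)h^\alpha}I-\Delta\Big)w^n=\frac{1}{\Gamma(2-\alpha)h^\alpha}\,\bar\chi^{\,n-1}$$ is the unique minimizer over $H^1(\Omega)$ of $$\mathcal{J}_n(w)=\frac12\int_\Omega |\nabla w|^2\,dx+\frac{1}{2\Gamma(2-\alpha)h^\alpha}\int_\Omega |w-\bar\chi^{\,n-1}|^2\,dx .$$
   Context: $\Omega=[0,\Lambda)^d\cong\mathbb{T}^d$ is the flat torus with periodic boundary conditions and Lebesgue measure; functions here are real-valued, and $H^1(\Omega)$ is the periodic Sobolev space. $\Gamma$ is the Gamma function. L1 weights: $b_k:=(k+1)^{1-\alpha}-k^{1-\alpha}$ for $k\ge 0$. L1 history average: $$\bar\chi^{\,n-1}:=\sum_{j=1}^{n-1}(b_{j-1}-b_j)\,\chi^{n-j}+b_{n-1}\chi^0 .$$ Fractional Helmholtz-threshold scheme: start from $\chi^0\in L^\infty(\Omega;\{0,1\})$. For $n\ge1$, given $\chi^0,\dots,\chi^{n-1}$, let $w^n\in H^1(\Omega)$ be the weak solution of the displayed Helmholtz equation with the history average $\bar\chi^{\,n-1}$ as datum, and set $\chi^n:=\mathbf 1_{\{w^n>1/2\}}$.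 *)

theory Defs
  imports "HOL-Analysis.Analysis"
begin

section \<open>The flat torus\<close>

text \<open>
  A function on the torus is represented by its values on the fundamental cell
  \<open>[0, \<Lambda>)\<^sup>d\<close>; values outside the cell are irrelevant. All Lebesgue and Sobolev
  spaces below consist of functions rather than of equivalence classes, so equality of
  their elements is equality almost everywhere on the cell.
\<close>

definition torus_cell :: "real \<Rightarrow> (real^'d) set" where
  "torus_cell \<Lambda> = {x. \<forall>i. 0 \<le> x $ i \<and> x $ i < \<Lambda>}"

abbreviation torus :: "real \<Rightarrow> (real^'d) measure" where
  "torus \<Lambda> \<equiv> lebesgue_on (torus_cell \<Lambda>)"

definition L2_torus :: "real \<Rightarrow> (real^'d \<Rightarrow> real) set" where
  "L2_torus \<Lambda> = {u. u \<in> borel_measurable (torus \<Lambda>) \<and> integrable (torus \<Lambda>) (\<lambda>x. (u x)\<^sup>2)}"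

text \<open>The essential bound is automatic for functions with values in \<open>{0, 1}\<close>.\<close>

definition Linf_binary :: "real \<Rightarrow> (real^'d \<Rightarrow> real) set" where
  "Linf_binary \<Lambda> = {u. u \<in> borel_measurable (torus \<Lambda>) \<and> (AE x in torus \<Lambda>. u x \<in> {0, 1})}"


section \<open>The periodic Sobolev space\<close>

definition partial_deriv :: "'d \<Rightarrow> (real^'d \<Rightarrow> real) \<Rightarrow> real^'d \<Rightarrow> real" where
  "partial_deriv i f x = frechet_derivative f (at x) (axis i 1)"

primrec continuously_diff :: "nat \<Rightarrow> (real^'d \<Rightarrow> real) \<Rightarrow> bool" where
  "continuously_diff 0 f \<longleftrightarrow> continuous_on UNIV f"
| "continuously_diff (Suc k) f \<longleftrightarrow>
     f differentiable_on UNIV \<and> (\<forall>i. continuously_diff k (partial_deriv i f))"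

text \<open>
  Smooth functions on the torus, as smooth functions on the whole space that are
  \<open>\<Lambda>\<close>-periodic in every coordinate. They need not vanish near the boundary of the cell;
  testing against all of them is what encodes the periodic boundary conditions.
\<close>

definition periodic_smooth :: "real \<Rightarrow> (real^'d \<Rightarrow> real) set" where
  "periodic_smooth \<Lambda> =
     {\<phi>. (\<forall>k. continuously_diff k \<phi>) \<and> (\<forall>x i. \<phi> (x + axis i \<Lambda>) = \<phi> x)}"

definition has_weak_gradient ::
    "real \<Rightarrow> (real^'d \<Rightarrow> real) \<Rightarrow> (real^'d \<Rightarrow> real^'d) \<Rightarrow> bool" where
  "has_weak_gradient \<Lambda> u g \<longleftrightarrow>
     (\<forall>i. (\<lambda>x. g x $ i) \<in> L2_torus \<Lambda> \<and>
        (\<forall>\<phi> \<in> periodic_smooth \<Lambda>.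
           (\<integral>x. u x * partial_deriv i \<phi> x \<partial>torus \<Lambda>) = - (\<integral>x. g x $ i * \<phi> x \<partial>torus \<Lambda>)))"

definition H1_torus :: "real \<Rightarrow> (real^'d \<Rightarrow> real) set" where
  "H1_torus \<Lambda> = {u \<in> L2_torus \<Lambda>. \<exists>g. has_weak_gradient \<Lambda> u g}"

text \<open>The weak gradient is determined almost everywhere; this picks a representative.\<close>

definition weak_gradient :: "real \<Rightarrow> (real^'d \<Rightarrow> real) \<Rightarrow> real^'d \<Rightarrow> real^'d" where
  "weak_gradient \<Lambda> u = (SOME g. has_weak_gradient \<Lambda> u g)"


section \<open>The fractional Helmholtz-threshold scheme\<close>

definition L1_weight :: "real \<Rightarrow> nat \<Rightarrow> real" where
  "L1_weight \<alpha> k = real (k + 1) powr (1 - \<alpha>) - real k powr (1 - \<alpha>)"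

text \<open>
  \<open>L1_history \<alpha> chi m\<close> is the average with superscript \<open>m\<close>, i.e. the datum of step \<open>m + 1\<close>;
  it only involves \<open>chi 0, \<dots>, chi m\<close>.
\<close>

definition L1_history :: "real \<Rightarrow> (nat \<Rightarrow> 'a \<Rightarrow> real) \<Rightarrow> nat \<Rightarrow> 'a \<Rightarrow> real" where
  "L1_history \<alpha> chi m x =
     (\<Sum>j = 1..m. (L1_weight \<alpha> (j - 1) - L1_weight \<alpha> j) * chi (m + 1 - j) x)
       + L1_weight \<alpha> m * chi 0 x"

definition helmholtz_coeff :: "real \<Rightarrow> real \<Rightarrow> real" where
  "helmholtz_coeff \<alpha> h = 1 / (Gamma (2 - \<alpha>) * h powr \<alpha>)"

text \<open>Weak solutions of \<open>(c I - \<Delta>) w = c f\<close> with periodic boundary conditions.\<close>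

definition helmholtz_weak_solution ::
    "real \<Rightarrow> real \<Rightarrow> (real^'d \<Rightarrow> real) \<Rightarrow> (real^'d \<Rightarrow> real) \<Rightarrow> bool" where
  "helmholtz_weak_solution \<Lambda> c f w \<longleftrightarrow>
     w \<in> H1_torus \<Lambda> \<and>
     (\<forall>v \<in> H1_torus \<Lambda>.
        c * (\<integral>x. w x * v x \<partial>torus \<Lambda>)
          + (\<integral>x. weak_gradient \<Lambda> w x \<bullet> weak_gradient \<Lambda> v x \<partial>torus \<Lambda>)
        = c * (\<integral>x. f x * v x \<partial>torus \<Lambda>))"

text \<open>\<open>chi 0, \<dots>, chi (n - 1)\<close> are the first \<open>n\<close> states produced by the scheme.\<close>

definition threshold_scheme_states ::
    "real \<Rightarrow> real \<Rightarrow> real \<Rightarrow> nat \<Rightarrow> (nat \<Rightarrow> real^'d \<Rightarrow> real) \<Rightarrow> bool" where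
  "threshold_scheme_states \<Lambda> \<alpha> h n chi \<longleftrightarrow>
     chi 0 \<in> Linf_binary \<Lambda> \<and>
     (\<forall>k. 1 \<le> k \<and> k < n \<longrightarrow>
        (\<exists>w. helmholtz_weak_solution \<Lambda> (helmholtz_coeff \<alpha> h) (L1_history \<alpha> chi (k - 1)) w \<and>
             (AE x in torus \<Lambda>. chi k x = indicator {y. w y > 1 / 2} x)))"

definition J_functional ::
    "real \<Rightarrow> real \<Rightarrow> real \<Rightarrow> (real^'d \<Rightarrow> real) \<Rightarrow> (real^'d \<Rightarrow> real) \<Rightarrow> real" where
  "J_functional \<Lambda> \<alpha> h f w =
     1 / 2 * (\<integral>x. (norm (weak_gradient \<Lambda> w x))\<^sup>2 \<partial>torus \<Lambda>)
       + 1 / (2 * Gamma (2 - \<alpha>) * h powr \<alpha>) * (\<integral>x. \<bar>w x - f x\<bar>\<^sup>2 \<partial>torus \<Lambda>)"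

definition is_H1_minimizer ::
    "real \<Rightarrow> ((real^'d \<Rightarrow> real) \<Rightarrow> real) \<Rightarrow> (real^'d \<Rightarrow> real) \<Rightarrow> bool" where
  "is_H1_minimizer \<Lambda> F w \<longleftrightarrow> w \<in> H1_torus \<Lambda> \<and> (\<forall>v \<in> H1_torus \<Lambda>. F w \<le> F v)"

definition is_unique_H1_minimizer ::
    "real \<Rightarrow> ((real^'d \<Rightarrow> real) \<Rightarrow> real) \<Rightarrow> (real^'d \<Rightarrow> real) \<Rightarrow> bool" where
  "is_unique_H1_minimizer \<Lambda> F w \<longleftrightarrow>
     is_H1_minimizer \<Lambda> F w \<and>
     (\<forall>v. is_H1_minimizer \<Lambda> F v \<longrightarrow> (AE x in torus \<Lambda>. v x = w x))"

end

theory Submission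
  imports Defs
begin

text \<open>
  For a weak solution \<open>w\<close> and a competitor \<open>v\<close> in \<open>H\<^sup>1\<close>, expanding the squares and testing the equation
  with \<open>z = v - w\<close> cancels the cross terms, leaving
  \<open>J v = J w + 1/2 \<integral>\<bar>\<nabla>z\<bar>\<^sup>2 + c/2 \<integral>z\<^sup>2\<close>. Existence is an orthogonal projection in \<open>L\<^sup>2\<close>. Both need
  the chosen weak gradient to be linear up to null sets, i.e. weak gradients to be unique; this holds
  because indicators of orthants are bounded pointwise limits of trigonometric polynomials on the cell.
\<close>

section \<open>Square integrable functions\<close>

text \<open>Test functions have to be smooth and periodic on the whole space, so approximants of an
  indicator are built inside the test class: a polynomial in one cosine is again periodic and
  smooth, and Weierstrass supplies the polynomial. The price is that the limits are indicators only
  on the half-open cell, which is all that the integrals see. The projection is taken for pairs of a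
  value and a gradient, because the inner product of such pairs is the bilinear form of the
  equation; the factor \<open>sqrt c\<close> on the value is what produces the coefficient
  \<open>c\<close>. Completeness and projection are therefore developed for values in an arbitrary
  Euclidean space, so that functions, gradients and pairs share one theory.\<close>

definition square_integrable :: "'a measure \<Rightarrow> ('a \<Rightarrow> 'b::euclidean_space) \<Rightarrow> bool" where
  "square_integrable M u \<longleftrightarrow> u \<in> borel_measurable M \<and> integrable M (\<lambda>x. (norm (u x))\<^sup>2)"

lemma square_integrable_measurable: "square_integrable M u \<Longrightarrow> u \<in> borel_measurable M"
  and square_integrable_norm: "square_integrable M u \<Longrightarrow> integrable M (\<lambda>x. (norm (u x))\<^sup>2)"
  by (auto simp: square_integrable_def)

lemma square_integrable_bound:
  assumes "square_integrable M v" "u \<in> borel_measurable M" "\<And>x. norm (u x) \<le> norm (v x)"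
  shows "square_integrable M u"
  unfolding square_integrable_def
proof
  show "integrable M (\<lambda>x. (norm (u x))\<^sup>2)"
    using square_integrable_norm[OF assms(1)]
    by (rule Bochner_Integration.integrable_bound) (use assms in \<open>auto intro!: AE_I2 power_mono\<close>)
qed (fact assms)

lemma square_integrable_scaleR:
  "square_integrable M u \<Longrightarrow> square_integrable M (\<lambda>x. c *\<^sub>R u x)"
  by (auto simp: square_integrable_def power_mult_distrib)

lemma norm_add_square_le: "(norm (a + b))\<^sup>2 \<le> 2 * (norm a)\<^sup>2 + 2 * (norm b)\<^sup>2"
  for a b :: "'b::real_inner"
proof -
  have "(norm (a + b))\<^sup>2 + (norm (a - b))\<^sup>2 = 2 * (norm a)\<^sup>2 + 2 * (norm b)\<^sup>2"
    by (simp add: power2_norm_eq_inner algebra_simps)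
  then show ?thesis
    using zero_le_power2[of "norm (a - b)"] by linarith
qed

lemma square_integrable_add:
  assumes "square_integrable M u" "square_integrable M v"
  shows "square_integrable M (\<lambda>x. u x + v x)"
  unfolding square_integrable_def
proof
  show m: "(\<lambda>x. u x + v x) \<in> borel_measurable M"
    using assms by (auto simp: square_integrable_def)
  have "integrable M (\<lambda>x. 2 * (norm (u x))\<^sup>2 + 2 * (norm (v x))\<^sup>2)"
    using assms by (auto simp: square_integrable_def)
  then show "integrable M (\<lambda>x. (norm (u x + v x))\<^sup>2)"
    by (rule Bochner_Integration.integrable_bound)
      (use m norm_add_square_le in \<open>auto intro!: AE_I2\<close>)
qed

lemma square_integrable_diff:
  assumes "square_integrable M u" "square_integrable M v"
  shows "square_integrable M (\<lambda>x. u x - v x)"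
  using square_integrable_add[OF assms(1) square_integrable_scaleR[OF assms(2), of "-1"]] by simp

text \<open>Polarisation writes the inner product through squared norms of \<open>u + v\<close>,
  \<open>u\<close> and \<open>v\<close>, each of which is integrable; measurability comes along with
  it.\<close>

lemma square_integrable_inner:
  assumes "square_integrable M u" "square_integrable M v"
  shows "integrable M (\<lambda>x. u x \<bullet> v x)"
proof -
  have "integrable M (\<lambda>x. ((norm (u x + v x))\<^sup>2 - (norm (u x))\<^sup>2 - (norm (v x))\<^sup>2) / 2)"
    using assms square_integrable_add[OF assms] by (auto simp: square_integrable_def)
  also have "(\<lambda>x. ((norm (u x + v x))\<^sup>2 - (norm (u x))\<^sup>2 - (norm (v x))\<^sup>2) / 2) = (\<lambda>x. u x \<bullet> v x)"
    by (simp add: power2_norm_eq_inner algebra_simps inner_commute)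
  finally show ?thesis .
qed

text \<open>The integral of the squared norm of \<open>s u + t v\<close> is a nonnegative quadratic
  form in \<open>s\<close> and \<open>t\<close>. Taking \<open>s = C\<close>, \<open>t = - B\<close>
  gives \<open>C (A C - B^2)\<close> without a division. If \<open>C = 0\<close> the form is affine
  in \<open>t\<close> for \<open>s = 1\<close>, and a nonzero \<open>B\<close> would allow the value
  \<open>-1\<close>.\<close>

lemma square_integrable_cauchy_schwarz:
  assumes "square_integrable M u" "square_integrable M v"
  shows "(\<integral>x. u x \<bullet> v x \<partial>M)\<^sup>2 \<le> (\<integral>x. (norm (u x))\<^sup>2 \<partial>M) * (\<integral>x. (norm (v x))\<^sup>2 \<partial>M)"
proof -
  define A B C where "A = (\<integral>x. (norm (u x))\<^sup>2 \<partial>M)" and "B = (\<integral>x. u x \<bullet> v x \<partial>M)"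
    and "C = (\<integral>x. (norm (v x))\<^sup>2 \<partial>M)"
  have int: "integrable M (\<lambda>x. (norm (u x))\<^sup>2)" "integrable M (\<lambda>x. u x \<bullet> v x)"
      "integrable M (\<lambda>x. (norm (v x))\<^sup>2)"
    using assms square_integrable_inner by (auto simp: square_integrable_def)
  have q: "0 \<le> s\<^sup>2 * A + 2 * s * t * B + t\<^sup>2 * C" for s t
  proof -
    have "(\<lambda>x. (norm (s *\<^sub>R u x + t *\<^sub>R v x))\<^sup>2) =
        (\<lambda>x. s\<^sup>2 * (norm (u x))\<^sup>2 + 2 * s * t * (u x \<bullet> v x) + t\<^sup>2 * (norm (v x))\<^sup>2)"
      unfolding power2_norm_eq_inner
      by (simp add: algebra_simps inner_commute power2_eq_square)
    then have "(\<integral>x. (norm (s *\<^sub>R u x + t *\<^sub>R v x))\<^sup>2 \<partial>M) = s\<^sup>2 * A + 2 * s * t * B + t\<^sup>2 * C"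
      using int by (simp add: A_def B_def C_def)
    then show ?thesis
      using Bochner_Integration.integral_nonneg[of M "\<lambda>x. (norm (s *\<^sub>R u x + t *\<^sub>R v x))\<^sup>2"]
      by simp
  qed
  have nonneg: "0 \<le> A" "0 \<le> C"
    unfolding A_def C_def by simp_all
  have "B\<^sup>2 \<le> A * C"
  proof (cases "C = 0")
    case True
    have "B = 0"
    proof (rule ccontr)
      assume "B \<noteq> 0"
      then show False
        using q[of 1 "- (A + 1) / (2 * B)"] nonneg True by (simp add: field_simps)
    qed
    then show ?thesis
      using nonneg by simp
  next
    case False
    then have "0 \<le> C * (A * C - B\<^sup>2)"
      using q[of C "- B"] by (simp add: power2_eq_square algebra_simps)
    then show ?thesis
      using False nonneg by (simp add: zero_le_mult_iff)
  qed
  then show ?thesis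
    unfolding A_def B_def C_def .
qed

text \<open>Cauchy-Schwarz bounds the squared difference of the two integrals by the squared
  distance times a constant. The lemma serves twice: for the limit of a minimising sequence, and for
  the closedness of an annihilator.\<close>

lemma square_integrable_tendsto_inner:
  assumes "\<And>n. square_integrable M (u n)" "square_integrable M u'" "square_integrable M v"
    and lim: "(\<lambda>n. \<integral>x. (norm (u n x - u' x))\<^sup>2 \<partial>M) \<longlonglongrightarrow> 0"
  shows "(\<lambda>n. \<integral>x. u n x \<bullet> v x \<partial>M) \<longlonglongrightarrow> (\<integral>x. u' x \<bullet> v x \<partial>M)"
proof -
  let ?d = "\<lambda>n. (\<integral>x. u n x \<bullet> v x \<partial>M) - (\<integral>x. u' x \<bullet> v x \<partial>M)"
  have d: "?d n = (\<integral>x. (u n x - u' x) \<bullet> v x \<partial>M)" for n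
    using square_integrable_inner[OF assms(1,3)] square_integrable_inner[OF assms(2,3)]
    by (simp add: inner_diff_left)
  have "(\<lambda>n. (?d n)\<^sup>2) \<longlonglongrightarrow> 0"
  proof (rule tendsto_sandwich[of "\<lambda>_. 0"])
    show "(\<lambda>n. (\<integral>x. (norm (u n x - u' x))\<^sup>2 \<partial>M) * (\<integral>x. (norm (v x))\<^sup>2 \<partial>M)) \<longlonglongrightarrow> 0"
      using tendsto_mult_left_zero[OF lim] .
    show "\<forall>\<^sub>F n in sequentially. (?d n)\<^sup>2 \<le> (\<integral>x. (norm (u n x - u' x))\<^sup>2 \<partial>M) * (\<integral>x. (norm (v x))\<^sup>2 \<partial>M)"
      unfolding d using assms
      by (intro always_eventually allI square_integrable_cauchy_schwarz square_integrable_diff)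
  qed auto
  then have "?d \<longlonglongrightarrow> 0"
    using tendsto_real_sqrt tendsto_rabs_zero_cancel by fastforce
  then show ?thesis
    by (rule LIM_zero_cancel)
qed

text \<open>Riesz-Fischer: along a subsequence with \<open>\<parallel>u (r (k + 1)) - u (r k)\<parallel>\<^sup>2 < 4\<^sup>-\<^sup>k\<close> the increments are
  summable almost everywhere, and Fatou's lemma turns the pointwise limit into a limit in the mean.\<close>

lemma square_integrable_complete:
  fixes u :: "nat \<Rightarrow> 'a \<Rightarrow> 'b::euclidean_space"
  assumes "finite_measure M" and u: "\<And>n. square_integrable M (u n)"
    and cauchy: "\<And>e. 0 < e \<Longrightarrow> \<exists>N. \<forall>m\<ge>N. \<forall>n\<ge>N. (\<integral>x. (norm (u m x - u n x))\<^sup>2 \<partial>M) < e"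
  obtains v where "square_integrable M v" "(\<lambda>n. \<integral>x. (norm (u n x - v x))\<^sup>2 \<partial>M) \<longlonglongrightarrow> 0"
proof -
  interpret finite_measure M by fact
  note [measurable] = square_integrable_measurable[OF u]
  have int: "integrable M (\<lambda>x. (norm (u m x - u n x))\<^sup>2)" for m n
    using square_integrable_diff[OF u u] by (rule square_integrable_norm)
  have "\<exists>N. \<forall>m\<ge>N. \<forall>n\<ge>N. (\<integral>x. (norm (u m x - u n x))\<^sup>2 \<partial>M) < (1 / 4) ^ k" for k
    by (rule cauchy) simp
  then obtain r0 where r0:
      "\<And>k m n. r0 k \<le> m \<Longrightarrow> r0 k \<le> n \<Longrightarrow> (\<integral>x. (norm (u m x - u n x))\<^sup>2 \<partial>M) < (1 / 4) ^ k"
    by metis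
  \<comment> \<open>Summing the thresholds makes them monotone while each still dominates
    \<open>r0 k\<close>.\<close>
  define r where "r k = (\<Sum>i\<le>k. r0 i)" for k
  have r_mono: "r k \<le> r l" if "k \<le> l" for k l
    unfolding r_def using that by (intro sum_mono2) auto
  have r0_le: "r0 k \<le> r k" for k
    unfolding r_def by (rule member_le_sum) auto
  have r: "(\<integral>x. (norm (u m x - u n x))\<^sup>2 \<partial>M) < (1 / 4) ^ k" if "r k \<le> m" "r k \<le> n" for k m n
    using r0[of k m n] that r0_le[of k] by linarith
  define D where "D k x = norm (u (r (Suc k)) x - u (r k) x)" for k x
  have [measurable]: "D k \<in> borel_measurable M" for k
    unfolding D_def by measurable
  \<comment> \<open>Expanding a square with weight \<open>2 ^ k\<close> bounds the increment by its
    square. The weight is balanced against the \<open>4\<close>-adic bound on the squared norm: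
    since the measure is finite, both terms integrate to a multiple of
    \<open>(1 / 2) ^ k\<close>.\<close>
  have D_le: "D k x \<le> (1 / 2) ^ k + 2 ^ k * (D k x)\<^sup>2" for k x
  proof -
    have "0 \<le> (1 / 2) ^ k * (1 - 2 ^ k * D k x)\<^sup>2"
      by simp
    also have "\<dots> = (1 / 2) ^ k + 2 ^ k * (D k x)\<^sup>2 - 2 * D k x"
      by (simp add: power2_eq_square field_simps power_one_over)
    finally have "2 * D k x \<le> (1 / 2) ^ k + 2 ^ k * (D k x)\<^sup>2"
      by simp
    moreover have "0 \<le> D k x"
      by (simp add: D_def)
    ultimately show ?thesis
      by linarith
  qed
  have D_nn: "(\<integral>\<^sup>+x. ennreal (D k x) \<partial>M) \<le> ennreal ((1 / 2) ^ k * (measure M (space M) + 1))" for k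
  proof -
    have "(\<integral>\<^sup>+x. ennreal (D k x) \<partial>M) \<le> (\<integral>\<^sup>+x. ennreal ((1 / 2) ^ k + 2 ^ k * (D k x)\<^sup>2) \<partial>M)"
      using D_le by (intro nn_integral_mono ennreal_leI)
    also have "\<dots> = ennreal (\<integral>x. (1 / 2) ^ k + 2 ^ k * (D k x)\<^sup>2 \<partial>M)"
      using int unfolding D_def by (intro nn_integral_eq_integral) auto
    also have "(\<integral>x. (1 / 2) ^ k + 2 ^ k * (D k x)\<^sup>2 \<partial>M) =
        (1 / 2) ^ k * measure M (space M) + 2 ^ k * (\<integral>x. (D k x)\<^sup>2 \<partial>M)"
      using int unfolding D_def by (subst Bochner_Integration.integral_add) auto
    also have "\<dots> \<le> (1 / 2) ^ k * measure M (space M) + 2 ^ k * (1 / 4) ^ k"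
      using r[of k "r (Suc k)" "r k"] r_mono[of k "Suc k"] unfolding D_def
      by (intro add_left_mono mult_left_mono) auto
    also have "\<dots> = (1 / 2) ^ k * (measure M (space M) + 1)"
      by (simp add: distrib_left flip: power_mult_distrib)
    finally show ?thesis
      by (simp add: ennreal_leI)
  qed
  have "(\<integral>\<^sup>+x. (\<Sum>k. ennreal (D k x)) \<partial>M) = (\<Sum>k. \<integral>\<^sup>+x. ennreal (D k x) \<partial>M)"
    by (rule nn_integral_suminf) measurable
  also have "\<dots> \<le> (\<Sum>k. ennreal ((1 / 2) ^ k * (measure M (space M) + 1)))"
    using D_nn by (intro suminf_le) auto
  also have "\<dots> < \<infinity>"
    by (subst suminf_ennreal2) (auto intro!: summable_mult2 summable_geometric)
  finally have "AE x in M. (\<Sum>k. ennreal (D k x)) \<noteq> \<infinity>"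
    by (intro nn_integral_PInf_AE) (auto simp: less_top)
  then have conv: "AE x in M. convergent (\<lambda>k. u (r k) x)"
  proof eventually_elim
    case (elim x)
    then have "summable (\<lambda>k. D k x)"
      by (intro summable_suminf_not_top) (auto simp: D_def)
    then have "summable (\<lambda>k. u (r (Suc k)) x - u (r k) x)"
      unfolding D_def by (rule summable_norm_cancel)
    then have "convergent (\<lambda>n. \<Sum>k<n. u (r (Suc k)) x - u (r k) x)"
      by (simp add: summable_iff_convergent)
    then have "convergent (\<lambda>n. u (r n) x - u (r 0) x)"
      by (simp add: sum_lessThan_telescope[of "\<lambda>k. u (r k) x"])
    then show ?case
      using convergent_add[OF _ convergent_const[of "u (r 0) x"]] by fastforce
  qed
  \<comment> \<open>\<open>lim\<close> is total, so \<open>v\<close> is measurable on the whole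
    space; its values where the subsequence diverges lie over a null set.\<close>
  define v where "v x = lim (\<lambda>k. u (r k) x)" for x
  have [measurable]: "v \<in> borel_measurable M"
    unfolding v_def by measurable
  \<comment> \<open>The bound covers every index above the threshold, not only those of the
    subsequence, so the full sequence converges.\<close>
  have dist: "(\<integral>\<^sup>+x. ennreal ((norm (u n x - v x))\<^sup>2) \<partial>M) \<le> ennreal ((1 / 4) ^ k)" if "r k \<le> n" for k n
  proof -
    have "(\<integral>\<^sup>+x. ennreal ((norm (u n x - v x))\<^sup>2) \<partial>M) =
        (\<integral>\<^sup>+x. liminf (\<lambda>j. ennreal ((norm (u n x - u (r j) x))\<^sup>2)) \<partial>M)"
    proof (rule nn_integral_cong_AE)
      show "AE x in M. ennreal ((norm (u n x - v x))\<^sup>2) = liminf (\<lambda>j. ennreal ((norm (u n x - u (r j) x))\<^sup>2))"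
        using conv
      proof eventually_elim
        case (elim x)
        then have "(\<lambda>j. u (r j) x) \<longlonglongrightarrow> v x"
          unfolding v_def by (simp add: convergent_LIMSEQ_iff)
        then have "(\<lambda>j. ennreal ((norm (u n x - u (r j) x))\<^sup>2)) \<longlonglongrightarrow> ennreal ((norm (u n x - v x))\<^sup>2)"
          by (intro tendsto_intros tendsto_ennrealI)
        then show ?case
          by (rule lim_imp_Liminf[OF trivial_limit_sequentially, symmetric])
      qed
    qed
    also have "\<dots> \<le> liminf (\<lambda>j. \<integral>\<^sup>+x. ennreal ((norm (u n x - u (r j) x))\<^sup>2) \<partial>M)"
      by (rule nn_integral_liminf) measurable
    also have "\<dots> \<le> ennreal ((1 / 4) ^ k)"
    proof (rule Liminf_le)
      show "\<forall>\<^sub>F j in sequentially.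
          (\<integral>\<^sup>+x. ennreal ((norm (u n x - u (r j) x))\<^sup>2) \<partial>M) \<le> ennreal ((1 / 4) ^ k)"
        using eventually_ge_at_top[of k]
      proof eventually_elim
        case (elim j)
        have "(\<integral>\<^sup>+x. ennreal ((norm (u n x - u (r j) x))\<^sup>2) \<partial>M) =
            ennreal (\<integral>x. (norm (u n x - u (r j) x))\<^sup>2 \<partial>M)"
          using int by (intro nn_integral_eq_integral) auto
        then show ?case
          using r[of k n "r j"] that r_mono[OF elim] by (simp add: ennreal_leI)
      qed
    qed simp
    finally show ?thesis .
  qed
  have d: "square_integrable M (\<lambda>x. u n x - v x)" if "r 0 \<le> n" for n
    unfolding square_integrable_def
  proof
    show "integrable M (\<lambda>x. (norm (u n x - v x))\<^sup>2)"
      using dist[OF that] by (intro integrableI_bounded) (auto intro: le_less_trans)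
  qed measurable
  have "square_integrable M v"
    using square_integrable_diff[OF u[of "r 0"] d[of "r 0"]] by simp
  moreover have "(\<lambda>n. \<integral>x. (norm (u n x - v x))\<^sup>2 \<partial>M) \<longlonglongrightarrow> 0"
  proof (rule LIMSEQ_I)
    fix e :: real
    assume "0 < e"
    then obtain k where k: "(1 / 4) ^ k < e"
      using real_arch_pow_inv[of e "1 / 4"] by auto
    have "norm ((\<integral>x. (norm (u n x - v x))\<^sup>2 \<partial>M) - 0) < e" if "r k \<le> n" for n
    proof -
      have "integrable M (\<lambda>x. (norm (u n x - v x))\<^sup>2)"
        using d[of n] that r_mono[of 0 k] by (auto simp: square_integrable_def)
      then have "ennreal (\<integral>x. (norm (u n x - v x))\<^sup>2 \<partial>M) \<le> ennreal ((1 / 4) ^ k)"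
        using dist[OF that] by (subst (asm) nn_integral_eq_integral) auto
      then show ?thesis
        using k by (simp add: ennreal_le_iff)
    qed
    then show "\<exists>N. \<forall>n\<ge>N. norm ((\<integral>x. (norm (u n x - v x))\<^sup>2 \<partial>M) - 0) < e"
      by blast
  qed
  ultimately show thesis
    by (rule that)
qed

section \<open>Orthogonal projection onto a closed subspace of square integrable functions\<close>

lemma quadratic_nonneg_imp_linear_zero:
  fixes b C :: real
  assumes "0 \<le> C" "\<And>t. 0 \<le> 2 * t * b + t\<^sup>2 * C"
  shows "b = 0"
proof -
  \<comment> \<open>The choice \<open>t = - s * b\<close> turns the quadratic into
    \<open>s * b^2 * (s * C - 2)\<close>. With this \<open>s\<close> the product
    \<open>s * C\<close> stays at most 1, also when \<open>C = 0\<close>, so the last factor is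
    negative.\<close>
  define s where "s = 1 / (C + 1)"
  have s: "0 < s" "s * C \<le> 1"
    using assms(1) by (auto simp: s_def)
  have "0 \<le> s * b\<^sup>2 * (s * C - 2)"
    using assms(2)[of "- s * b"] by (simp add: power2_eq_square algebra_simps)
  then have "s * b\<^sup>2 \<le> 0"
    using s by (simp add: zero_le_mult_iff)
  then show ?thesis
    using s by (simp add: mult_le_0_iff)
qed

text \<open>The integral of the squared difference is only a seminorm distance on functions, so
  closedness has to put every square integrable limit into \<open>S\<close>, whichever
  representative it is. The conclusion is the vanishing first variation of the distance to
  \<open>f\<close>, the form from which a weak equation can be read off.\<close>

lemma square_integrable_orthogonal_projection:
  fixes S :: "('a \<Rightarrow> 'b::euclidean_space) set"
  assumes "finite_measure M" and f: "square_integrable M f"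
    and S: "\<And>u. u \<in> S \<Longrightarrow> square_integrable M u" "(\<lambda>x. 0) \<in> S"
      "\<And>u v s t. u \<in> S \<Longrightarrow> v \<in> S \<Longrightarrow> (\<lambda>x. s *\<^sub>R u x + t *\<^sub>R v x) \<in> S"
    and closed: "\<And>u v. (\<And>n. u n \<in> S) \<Longrightarrow> square_integrable M v \<Longrightarrow>
      (\<lambda>n::nat. \<integral>x. (norm (u n x - v x))\<^sup>2 \<partial>M) \<longlonglongrightarrow> 0 \<Longrightarrow> v \<in> S"
  obtains u where "u \<in> S" "\<And>v. v \<in> S \<Longrightarrow> (\<integral>x. (u x - f x) \<bullet> v x \<partial>M) = 0"
proof -
  define E where "E u = (\<integral>x. (norm (u x - f x))\<^sup>2 \<partial>M)" for u
  have E_nonneg: "0 \<le> E u" for u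
    unfolding E_def by simp
  define m where "m = Inf (E ` S)"
  have bdd: "bdd_below (E ` S)"
    using E_nonneg by (intro bdd_belowI[of _ 0]) auto
  have m_le: "m \<le> E u" if "u \<in> S" for u
    unfolding m_def using bdd that by (intro cInf_lower) auto
  have sf: "square_integrable M (\<lambda>x. u x - f x)" if "u \<in> S" for u
    using square_integrable_diff[OF S(1)[OF that] f] .
  have "\<exists>u\<in>S. E u < m + 1 / real (Suc n)" for n
    using cInf_lessD[of "E ` S" "m + 1 / real (Suc n)"] S(2) unfolding m_def by auto
  then obtain u where u: "\<And>n. u n \<in> S" "\<And>n. E (u n) < m + 1 / real (Suc n)"
    by metis
  have parallelogram: "(\<integral>x. (norm (v x - w x))\<^sup>2 \<partial>M) \<le> 2 * E v + 2 * E w - 4 * m"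
    if "v \<in> S" "w \<in> S" for v w
  proof -
    \<comment> \<open>The midpoint lies in \<open>S\<close>, so its squared distance to
      \<open>f\<close> is at least \<open>m\<close>; this lower bound makes a minimising sequence
      Cauchy.\<close>
    let ?z = "\<lambda>x. (1 / 2) *\<^sub>R v x + (1 / 2) *\<^sub>R w x"
    have z: "?z \<in> S"
      using S(3)[OF that] .
    have "(norm (v x - w x))\<^sup>2 = 2 * (norm (v x - f x))\<^sup>2 + 2 * (norm (w x - f x))\<^sup>2 - 4 * (norm (?z x - f x))\<^sup>2"
      for x
      by (simp add: power2_norm_eq_inner algebra_simps inner_commute)
    then have "(\<integral>x. (norm (v x - w x))\<^sup>2 \<partial>M) = 2 * E v + 2 * E w - 4 * E ?z"
      using sf[OF that(1)] sf[OF that(2)] sf[OF z] unfolding E_def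
      by (simp add: square_integrable_def)
    then show ?thesis
      using m_le[OF z] by linarith
  qed
  obtain v where v: "square_integrable M v" "(\<lambda>n. \<integral>x. (norm (u n x - v x))\<^sup>2 \<partial>M) \<longlonglongrightarrow> 0"
  proof (rule square_integrable_complete[OF assms(1) S(1)[OF u(1)]])
    fix e :: real
    assume "0 < e"
    \<comment> \<open>Two members of the sequence whose squared distances to \<open>f\<close> exceed
      \<open>m\<close> by less than \<open>1 / real (Suc N)\<close> are at squared distance below
      four times this number.\<close>
    then obtain N where N: "1 / real (Suc N) < e / 4"
      using nat_approx_posE[of "e / 4"] by auto
    have "(\<integral>x. (norm (u j x - u k x))\<^sup>2 \<partial>M) < e" if "N \<le> j" "N \<le> k" for j k
    proof -
      have "1 / real (Suc j) \<le> 1 / real (Suc N)" "1 / real (Suc k) \<le> 1 / real (Suc N)"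
        using that by (auto simp: frac_le)
      then show ?thesis
        using parallelogram[OF u(1) u(1), of j k] u(2)[of j] u(2)[of k] N by linarith
    qed
    then show "\<exists>N. \<forall>j\<ge>N. \<forall>k\<ge>N. (\<integral>x. (norm (u j x - u k x))\<^sup>2 \<partial>M) < e"
      by blast
  qed
  have vS: "v \<in> S"
    using closed[OF u(1) v] .
  text \<open>Testing the minimising sequence directly avoids continuity of the distance.\<close>
  have "(\<integral>x. (v x - f x) \<bullet> w x \<partial>M) = 0" if w: "w \<in> S" for w
  proof -
    define B where "B n = (\<integral>x. (u n x - f x) \<bullet> w x \<partial>M)" for n
    define C where "C = (\<integral>x. (norm (w x))\<^sup>2 \<partial>M)"
    have C: "0 \<le> C"
      unfolding C_def by simp
    have sw: "square_integrable M w"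
      using S(1)[OF w] .
    have q: "0 \<le> 1 / real (Suc n) + 2 * t * B n + t\<^sup>2 * C" for n t
    proof -
      let ?z = "\<lambda>x. 1 *\<^sub>R u n x + t *\<^sub>R w x"
      have "(norm (?z x - f x))\<^sup>2 =
          (norm (u n x - f x))\<^sup>2 + 2 * t * ((u n x - f x) \<bullet> w x) + t\<^sup>2 * (norm (w x))\<^sup>2" for x
        unfolding power2_norm_eq_inner
        by (simp add: algebra_simps inner_commute power2_eq_square)
      then have "E ?z = E (u n) + 2 * t * B n + t\<^sup>2 * C"
        using sf[OF u(1)] sw square_integrable_inner[OF sf[OF u(1)] sw]
        unfolding E_def B_def C_def by (simp add: square_integrable_def)
      then show ?thesis
        using m_le[OF S(3)[OF u(1) w, of 1 n t]] u(2)[of n] by linarith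
    qed
    have lim: "B \<longlonglongrightarrow> (\<integral>x. (v x - f x) \<bullet> w x \<partial>M)"
      unfolding B_def
      by (rule square_integrable_tendsto_inner)
        (use sf[OF u(1)] sf[OF vS] sw v(2) in auto)
    let ?b = "\<integral>x. (v x - f x) \<bullet> w x \<partial>M"
    \<comment> \<open>For fixed \<open>t\<close> the slack \<open>1 / real (Suc n)\<close>
      disappears in the limit. What remains is a nonnegative quadratic in \<open>t\<close> without
      constant term, so its linear coefficient vanishes.\<close>
    have q': "0 \<le> 2 * t * ?b + t\<^sup>2 * C" for t
    proof -
      have "(\<lambda>n. 1 / real (Suc n) + 2 * t * B n + t\<^sup>2 * C) \<longlonglongrightarrow> 0 + 2 * t * ?b + t\<^sup>2 * C"
        using lim LIMSEQ_inverse_real_of_nat by (intro tendsto_intros) (simp_all add: inverse_eq_divide)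
      then show ?thesis
        using q by (intro LIMSEQ_le_const) auto
    qed
    show ?thesis
      using C q' by (rule quadratic_nonneg_imp_linear_zero)
  qed
  then show thesis
    using that[OF vS] by blast
qed

lemma square_integrable_bounded:
  assumes "finite_measure M" "v \<in> borel_measurable M" "\<And>x. x \<in> space M \<Longrightarrow> norm (v x) \<le> B"
  shows "square_integrable M v"
  unfolding square_integrable_def
proof
  interpret finite_measure M by fact
  show "integrable M (\<lambda>x. (norm (v x))\<^sup>2)"
    using assms(2,3) by (intro integrable_const_bound[of _ "B\<^sup>2"]) (auto intro!: power_mono)
qed (fact assms)

lemma square_integrable_integrable:
  fixes u :: "'a \<Rightarrow> real"
  assumes "finite_measure M" "square_integrable M u"
  shows "integrable M u"
  using square_integrable_inner[OF assms(2) square_integrable_bounded[OF assms(1), of "\<lambda>_. 1" 1]]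
  by simp

lemma square_integrable_Pair:
  "square_integrable M (\<lambda>x. (u x, v x)) \<longleftrightarrow> square_integrable M u \<and> square_integrable M v"
proof
  assume uv: "square_integrable M (\<lambda>x. (u x, v x))"
  then have m: "(\<lambda>x. (u x, v x)) \<in> borel_measurable M"
    by (rule square_integrable_measurable)
  have "(\<lambda>x. fst (u x, v x)) \<in> borel_measurable M"
    by (rule measurable_compose[OF m borel_measurable_continuous_onI[OF continuous_on_fst[OF continuous_on_id]]])
  moreover have "(\<lambda>x. snd (u x, v x)) \<in> borel_measurable M"
    by (rule measurable_compose[OF m borel_measurable_continuous_onI[OF continuous_on_snd[OF continuous_on_id]]])
  ultimately show "square_integrable M u \<and> square_integrable M v"
    using square_integrable_bound[OF uv, of u] square_integrable_bound[OF uv, of v]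
    by (simp add: norm_fst_le norm_snd_le)
qed (auto simp: square_integrable_def norm_Pair)

lemma square_integrable_vec:
  fixes g :: "'a \<Rightarrow> real^'d"
  shows "square_integrable M g \<longleftrightarrow> (\<forall>i. square_integrable M (\<lambda>x. g x $ i))"
proof
  assume g: "square_integrable M g"
  have "(\<lambda>x. g x $ i) \<in> borel_measurable M" for i
    using square_integrable_measurable[OF g]
    by (rule measurable_compose) (intro borel_measurable_continuous_onI continuous_intros)
  then show "\<forall>i. square_integrable M (\<lambda>x. g x $ i)"
    using square_integrable_bound[OF g] component_le_norm_cart by (metis real_norm_def)
next
  assume g: "\<forall>i. square_integrable M (\<lambda>x. g x $ i)"
  have "g \<in> borel_measurable M"
    unfolding borel_measurable_euclidean_space[of g]
    using g by (auto simp: Basis_vec_def inner_axis square_integrable_def)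
  moreover have "(norm (g x))\<^sup>2 = (\<Sum>i\<in>UNIV. (g x $ i)\<^sup>2)" for x
    unfolding power2_norm_eq_inner inner_vec_def by (simp add: power2_eq_square)
  ultimately show "square_integrable M g"
    using g by (auto simp: square_integrable_def)
qed

section \<open>Periodic smooth functions\<close>

lemma partial_deriv_has_derivative:
  assumes "(f has_derivative f') (at x)"
  shows "partial_deriv i f x = f' (axis i 1)"
  using frechet_derivative_at[OF assms] by (simp add: partial_deriv_def)

lemma continuously_diff_const: "continuously_diff k (\<lambda>x. c)"
proof (induction k arbitrary: c)
  case (Suc k)
  have "partial_deriv i (\<lambda>x. c) = (\<lambda>x. 0)" for i :: 'a
    using partial_deriv_has_derivative[OF has_derivative_const] by blast
  then show ?case
    using Suc by simp
qed simp

lemma continuously_diff_SucD: "continuously_diff (Suc k) f \<Longrightarrow> continuously_diff k f"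
  by (induction k arbitrary: f) (auto intro: differentiable_imp_continuous_on)

lemma continuously_diff_add:
  "continuously_diff k f \<Longrightarrow> continuously_diff k g \<Longrightarrow> continuously_diff k (\<lambda>x. f x + g x)"
proof (induction k arbitrary: f g)
  case (Suc k)
  have d: "f differentiable at x" "g differentiable at x" for x
    using Suc.prems by (auto simp: differentiable_on_def)
  have "partial_deriv i (\<lambda>x. f x + g x) = (\<lambda>x. partial_deriv i f x + partial_deriv i g x)" for i
  proof
    fix x
    show "partial_deriv i (\<lambda>x. f x + g x) x = partial_deriv i f x + partial_deriv i g x"
      using partial_deriv_has_derivative[OF has_derivative_add[OF d[THEN frechet_derivative_works[THEN iffD1]]]]
      by (simp add: partial_deriv_def)
  qed
  then show ?case
    using Suc by (auto intro: differentiable_on_add)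
qed (auto intro: continuous_on_add)

lemma continuously_diff_mult:
  "continuously_diff k f \<Longrightarrow> continuously_diff k g \<Longrightarrow> continuously_diff k (\<lambda>x. f x * g x)"
proof (induction k arbitrary: f g)
  case (Suc k)
  have d: "f differentiable at x" "g differentiable at x" for x
    using Suc.prems by (auto simp: differentiable_on_def)
  have "partial_deriv i (\<lambda>x. f x * g x) =
      (\<lambda>x. f x * partial_deriv i g x + partial_deriv i f x * g x)" for i
  proof
    fix x
    show "partial_deriv i (\<lambda>x. f x * g x) x = f x * partial_deriv i g x + partial_deriv i f x * g x"
      using partial_deriv_has_derivative[OF has_derivative_mult[OF d[THEN frechet_derivative_works[THEN iffD1]]]]
      by (simp add: partial_deriv_def)
  qed
  moreover have "continuously_diff k f" "continuously_diff k g"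
    using Suc.prems continuously_diff_SucD by blast+
  ultimately show ?case
    using Suc by (auto intro: differentiable_on_mult continuously_diff_add)
qed (auto intro: continuous_on_mult)

text \<open>The free phase \<open>c\<close> closes the family under differentiation up to a constant
  factor: differentiating a cosine shifts its phase by \<open>pi / 2\<close>, so one induction
  covers sines as well.\<close>

lemma continuously_diff_cos: "continuously_diff k (\<lambda>x. cos (\<omega> * (x $ i) + c))"
proof (induction k arbitrary: c)
  case 0
  show ?case
    by (auto intro!: continuous_intros)
next
  case (Suc k)
  have der: "((\<lambda>x. cos (\<omega> * (x $ i) + c)) has_derivative
      (\<lambda>v. - sin (\<omega> * (x $ i) + c) * (\<omega> * v $ i))) (at x)" for x :: "real^'a"
    by (auto intro!: derivative_eq_intros bounded_linear.has_derivative[OF bounded_linear_vec_nth])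
  have "partial_deriv j (\<lambda>x. cos (\<omega> * (x $ i) + c)) =
      (\<lambda>x. (if j = i then \<omega> else 0) * cos (\<omega> * (x $ i) + (c + pi / 2)))" for j
  proof
    fix x :: "real^'a"
    have "cos (\<omega> * (x $ i) + (c + pi / 2)) = - sin (\<omega> * (x $ i) + c)"
      using minus_sin_cos_eq[of "\<omega> * (x $ i) + c"] by (simp add: add.assoc)
    then show "partial_deriv j (\<lambda>x. cos (\<omega> * (x $ i) + c)) x =
        (if j = i then \<omega> else 0) * cos (\<omega> * (x $ i) + (c + pi / 2))"
      using partial_deriv_has_derivative[OF der] by (auto simp: axis_def)
  qed
  moreover have "(\<lambda>x. cos (\<omega> * (x $ i) + c)) differentiable_on UNIV"
    using der unfolding differentiable_on_def differentiable_def by blast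
  ultimately show ?case
    using Suc by (auto intro: continuously_diff_mult continuously_diff_const)
qed

lemma periodic_smooth_const: "(\<lambda>x. c) \<in> periodic_smooth \<Lambda>"
  by (simp add: periodic_smooth_def continuously_diff_const)

lemma periodic_smooth_add:
  "f \<in> periodic_smooth \<Lambda> \<Longrightarrow> g \<in> periodic_smooth \<Lambda> \<Longrightarrow> (\<lambda>x. f x + g x) \<in> periodic_smooth \<Lambda>"
  by (simp add: periodic_smooth_def continuously_diff_add)

lemma periodic_smooth_mult:
  "f \<in> periodic_smooth \<Lambda> \<Longrightarrow> g \<in> periodic_smooth \<Lambda> \<Longrightarrow> (\<lambda>x. f x * g x) \<in> periodic_smooth \<Lambda>"
  by (simp add: periodic_smooth_def continuously_diff_mult)

lemma periodic_smooth_prod: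
  "finite I \<Longrightarrow> (\<And>i. i \<in> I \<Longrightarrow> f i \<in> periodic_smooth \<Lambda>) \<Longrightarrow>
    (\<lambda>x. \<Prod>i\<in>I. f i x) \<in> periodic_smooth \<Lambda>"
  by (induction I rule: finite_induct) (auto intro: periodic_smooth_const periodic_smooth_mult)

lemma periodic_smooth_cos:
  assumes "\<Lambda> \<noteq> 0"
  shows "(\<lambda>x. cos (2 * pi / \<Lambda> * (x $ i) + c)) \<in> periodic_smooth \<Lambda>"
proof -
  have "cos (2 * pi / \<Lambda> * ((x + axis j \<Lambda>) $ i) + c) = cos (2 * pi / \<Lambda> * (x $ i) + c)"
    for x :: "real^'a" and j
  proof (cases "j = i")
    case True
    then have "2 * pi / \<Lambda> * ((x + axis j \<Lambda>) $ i) + c = (2 * pi / \<Lambda> * (x $ i) + c) + 2 * pi"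
      using assms by (simp add: axis_def field_simps)
    then show ?thesis
      by (metis cos_periodic)
  qed (simp add: axis_def)
  then show ?thesis
    unfolding periodic_smooth_def using continuously_diff_cos by blast
qed

text \<open>This keeps Weierstrass approximants of a function of \<open>\<phi> x\<close> inside the
  class of test functions.\<close>

lemma periodic_smooth_polynomial:
  fixes p :: "real \<Rightarrow> real"
  assumes "real_polynomial_function p" "\<phi> \<in> periodic_smooth \<Lambda>"
  shows "(\<lambda>x. p (\<phi> x)) \<in> periodic_smooth \<Lambda>"
  using assms(1)
proof induction
  case (linear p)
  then obtain c where "p = (\<lambda>x. x * c)"
    using real_bounded_linear[of p] by auto
  then show ?case
    using periodic_smooth_mult[OF assms(2) periodic_smooth_const] by auto
qed (auto intro: periodic_smooth_const periodic_smooth_add periodic_smooth_mult)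

lemma periodic_smooth_continuous:
  "\<phi> \<in> periodic_smooth \<Lambda> \<Longrightarrow> continuous_on UNIV \<phi>"
  unfolding periodic_smooth_def using continuously_diff.simps(1) by blast

lemma periodic_smooth_partial_deriv_continuous:
  assumes "\<phi> \<in> periodic_smooth \<Lambda>"
  shows "continuous_on UNIV (partial_deriv i \<phi>)"
proof -
  have "continuously_diff (Suc 0) \<phi>"
    using assms unfolding periodic_smooth_def by blast
  then show ?thesis
    by simp
qed

section \<open>Indicators as bounded pointwise limits of periodic smooth functions\<close>

lemma arc_approximation:
  fixes t :: "real^'d \<Rightarrow> real"
  assumes "t \<in> periodic_smooth \<Lambda>" and t: "\<And>x. \<bar>t x\<bar> \<le> 1"
  obtains q where "\<And>m::nat. q m \<in> periodic_smooth \<Lambda>" "\<And>m x. \<bar>q m x\<bar> \<le> 2"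
    "\<And>x. (\<lambda>m. q m x) \<longlonglongrightarrow> (if k \<le> t x then 1 else 0)"
proof -
  \<comment> \<open>For positive \<open>m\<close> this is a ramp of slope \<open>m\<close>, equal to
    0 up to \<open>k - 1/m\<close> and to 1 from \<open>k\<close> on. It is exactly 1 at the
    threshold itself, so the limit is the indicator of the closed condition
    \<open>k \<le> t x\<close>. A polynomial within \<open>1 / real (Suc m)\<close> of it on [-1, 1]
    has the same limit there and is bounded by 1 + 1.\<close>
  define F where "F m s = max 0 (min 1 (1 + real m * (s - k)))" for m s
  have "\<exists>p. real_polynomial_function p \<and> (\<forall>s\<in>{-1..1}. \<bar>F m s - p s\<bar> < 1 / real (Suc m))" for m
  proof -
    have "continuous_on {-1..1} (F m)"
      unfolding F_def by (intro continuous_intros)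
    then show ?thesis
      using Stone_Weierstrass_real_polynomial_function[of "{-1..1}" "F m" "1 / real (Suc m)"]
      by (metis compact_Icc of_nat_0_less_iff zero_less_Suc zero_less_divide_1_iff)
  qed
  then obtain p where p: "\<And>m. real_polynomial_function (p m)"
      "\<And>m s. s \<in> {-1..1} \<Longrightarrow> \<bar>F m s - p m s\<bar> < 1 / real (Suc m)"
    by metis
  have tI: "t x \<in> {-1..1}" for x
    using t[of x] by auto
  show thesis
  proof (rule that[of "\<lambda>m x. p m (t x)"])
    show "(\<lambda>x. p m (t x)) \<in> periodic_smooth \<Lambda>" for m
      using p(1) assms(1) by (rule periodic_smooth_polynomial)
    show "\<bar>p m (t x)\<bar> \<le> 2" for m x
    proof -
      have "\<bar>F m (t x)\<bar> \<le> 1" "1 / real (Suc m) \<le> 1"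
        by (auto simp: F_def)
      then show ?thesis
        using p(2)[OF tI[of x], of m] by linarith
    qed
    fix x
    have "(\<lambda>m. F m (t x) - p m (t x)) \<longlonglongrightarrow> 0"
      by (rule Lim_null_comparison[OF _ LIMSEQ_inverse_real_of_nat])
        (use p(2)[OF tI[of x]] in \<open>auto simp: inverse_eq_divide intro!: always_eventually less_imp_le\<close>)
    moreover have "(\<lambda>m. F m (t x)) \<longlonglongrightarrow> (if k \<le> t x then 1 else 0)"
    proof (rule tendsto_eventually)
      show "\<forall>\<^sub>F m in sequentially. F m (t x) = (if k \<le> t x then 1 else 0)"
      proof (cases "k \<le> t x")
        case False
        obtain M where M: "1 / (k - t x) < real M"
          using reals_Archimedean2 by blast
        have "F m (t x) = 0" if "M \<le> m" for m
        proof -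
          have "1 / (k - t x) \<le> real m"
            using M that by linarith
          then have "1 \<le> real m * (k - t x)"
            using False by (simp add: field_simps)
          then show ?thesis
            unfolding F_def by (simp add: algebra_simps)
        qed
        then show ?thesis
          using False eventually_at_top_linorder by auto
      qed (simp add: F_def)
    qed
    ultimately show "(\<lambda>m. p m (t x)) \<longlonglongrightarrow> (if k \<le> t x then 1 else 0)"
      using tendsto_diff by fastforce
  qed
qed

text \<open>On the circle of length \<open>\<Lambda>\<close> the interval from 0 to
  \<open>\<beta>\<close> is an arc with centre \<open>\<beta> / 2\<close>. A cosine centred there is
  at least its value at the end points of the arc precisely on the arc, so the half-space becomes a
  superlevel set of a test function.\<close>

lemma halfspace_approximation:
  fixes i :: "'d::finite"
  assumes "0 < \<Lambda>"
  obtains q where "\<And>m::nat. q m \<in> periodic_smooth \<Lambda>" "\<And>m x. \<bar>q m x\<bar> \<le> 2"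
    "\<And>x::real^'d. x \<in> torus_cell \<Lambda> \<Longrightarrow> (\<lambda>m. q m x) \<longlonglongrightarrow> (if x $ i \<le> \<beta> then 1 else 0)"
proof (cases "0 \<le> \<beta> \<and> \<beta> < \<Lambda>")
  \<comment> \<open>Outside this range of \<open>\<beta>\<close> the half-space contains the whole
    cell or misses it, so a constant sequence suffices.\<close>
  case False
  show thesis
  proof (rule that[of "\<lambda>m x. if \<beta> < 0 then 0 else 1"])
    fix x :: "real^'d"
    assume "x \<in> torus_cell \<Lambda>"
    then have "0 \<le> x $ i" "x $ i < \<Lambda>"
      by (auto simp: torus_cell_def)
    then show "(\<lambda>m::nat. if \<beta> < 0 then 0 else 1) \<longlonglongrightarrow> (if x $ i \<le> \<beta> then 1 else 0::real)"
      using False by auto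
  qed (auto intro: periodic_smooth_const)
next
  case True
  define t :: "real^'d \<Rightarrow> real" where "t x = cos (2 * pi / \<Lambda> * (x $ i) + (- pi * \<beta> / \<Lambda>))" for x
  have iff: "cos (pi * \<beta> / \<Lambda>) \<le> t x \<longleftrightarrow> x $ i \<le> \<beta>" if "x \<in> torus_cell \<Lambda>" for x
  proof -
    have x: "0 \<le> x $ i" "x $ i < \<Lambda>"
      using that by (auto simp: torus_cell_def)
    define y where "y = \<bar>2 * x $ i - \<beta>\<bar> * (pi / \<Lambda>)"
    define b where "b = \<beta> * (pi / \<Lambda>)"
    have pL: "0 < pi / \<Lambda>" and L: "\<Lambda> * (pi / \<Lambda>) = pi"
      using assms by simp_all
    have b: "0 \<le> b" "b \<le> pi"
      using True mult_right_mono[of \<beta> \<Lambda> "pi / \<Lambda>"] pL L unfolding b_def by auto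
    \<comment> \<open>The cell being half-open makes this strict. It excludes the angle
      \<open>2 * pi - b\<close>, where the cosine takes the value \<open>cos b\<close> once more;
      that angle belongs to \<open>x $ i = \<Lambda>\<close>, which is identified with 0 on the
      torus.\<close>
    have "\<bar>2 * x $ i - \<beta>\<bar> < 2 * \<Lambda> - \<beta>"
      using x True by linarith
    then have "y < (2 * \<Lambda> - \<beta>) * (pi / \<Lambda>)"
      unfolding y_def using pL by (rule mult_strict_right_mono)
    also have "(2 * \<Lambda> - \<beta>) * (pi / \<Lambda>) = 2 * pi - b"
      using L unfolding b_def by (simp only: left_diff_distrib mult.assoc)
    finally have y: "0 \<le> y" "y < 2 * pi - b"
      using mult_nonneg_nonneg[OF abs_ge_zero less_imp_le[OF pL]] unfolding y_def by blast+
    have "t x = cos y"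
    proof -
      have "y = \<bar>(2 * x $ i - \<beta>) * (pi / \<Lambda>)\<bar>"
        unfolding y_def abs_mult abs_of_pos[OF pL] ..
      moreover have "(2 * x $ i - \<beta>) * (pi / \<Lambda>) = 2 * pi / \<Lambda> * (x $ i) + (- pi * \<beta> / \<Lambda>)"
        using assms by (simp add: field_simps)
      ultimately show ?thesis
        unfolding t_def by (simp only: cos_abs_real)
    qed
    moreover have "cos b \<le> cos y \<longleftrightarrow> y \<le> b"
    proof (cases "y \<le> pi")
      case True
      then show ?thesis
        using b y cos_mono_le_eq by simp
    next
      case False
      \<comment> \<open>Past \<open>pi\<close> the cosine increases again; reflection brings the
        angle back into the decreasing range, strictly above \<open>b\<close>.\<close>
      have "cos y = cos (2 * pi - y)"
        by (simp add: cos_diff)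
      also have "\<dots> < cos b"
        by (rule cos_monotone_0_pi) (use b y False in auto)
      finally show ?thesis
        using False b by auto
    qed
    moreover have "y \<le> b \<longleftrightarrow> \<bar>2 * x $ i - \<beta>\<bar> \<le> \<beta>"
      unfolding y_def b_def using pL by (rule mult_le_cancel_right_pos)
    moreover have "\<bar>2 * x $ i - \<beta>\<bar> \<le> \<beta> \<longleftrightarrow> x $ i \<le> \<beta>"
      using x by linarith
    ultimately show ?thesis
      unfolding b_def by (simp add: mult.commute)
  qed
  have "t \<in> periodic_smooth \<Lambda>"
    unfolding t_def by (rule periodic_smooth_cos) (use assms in simp)
  moreover have "\<bar>t x\<bar> \<le> 1" for x
    by (simp add: t_def abs_cos_le_one)
  ultimately obtain q where q: "\<And>m::nat. q m \<in> periodic_smooth \<Lambda>" "\<And>m x. \<bar>q m x\<bar> \<le> 2"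
    "\<And>x. (\<lambda>m. q m x) \<longlonglongrightarrow> (if cos (pi * \<beta> / \<Lambda>) \<le> t x then 1 else 0)"
    by (rule arc_approximation[of t \<Lambda> "cos (pi * \<beta> / \<Lambda>)"]) blast
  show thesis
    by (rule that[of q, OF q(1,2)]) (simp only: iff[symmetric] q(3))
qed

text \<open>An orthant is the intersection of one half-space per coordinate, so products of the
  half-space approximants converge to its indicator, with one factor 2 per coordinate in the
  bound.\<close>

lemma orthant_approximation:
  fixes \<beta> :: "real^'d"
  assumes "0 < \<Lambda>"
  obtains q B where "\<And>m::nat. q m \<in> periodic_smooth \<Lambda>" "\<And>m x. \<bar>q m x\<bar> \<le> B"
    "\<And>x. x \<in> torus_cell \<Lambda> \<Longrightarrow> (\<lambda>m. q m x) \<longlonglongrightarrow> indicator {..\<beta>} x"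
proof -
  have "\<exists>q. (\<forall>m::nat. q m \<in> periodic_smooth \<Lambda>) \<and> (\<forall>m x. \<bar>q m x\<bar> \<le> 2) \<and>
      (\<forall>x::real^'d \<in> torus_cell \<Lambda>. (\<lambda>m. q m x) \<longlonglongrightarrow> (if x $ i \<le> \<beta> $ i then 1 else 0))" for i
    by (rule halfspace_approximation[OF assms, of i "\<beta> $ i"]) blast
  then obtain q where q: "\<And>i m. q i m \<in> periodic_smooth \<Lambda>" "\<And>i m x. \<bar>q i m x\<bar> \<le> 2"
      "\<And>i x. x \<in> torus_cell \<Lambda> \<Longrightarrow> (\<lambda>m. q i m x) \<longlonglongrightarrow> (if x $ i \<le> \<beta> $ i then 1 else 0)"
    by metis
  show thesis
  proof (rule that[of "\<lambda>m x. \<Prod>i\<in>UNIV. q i m x" "2 ^ CARD('d)"])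
    show "(\<lambda>x. \<Prod>i\<in>UNIV. q i m x) \<in> periodic_smooth \<Lambda>" for m
      using q(1) by (intro periodic_smooth_prod) auto
    show "\<bar>\<Prod>i\<in>UNIV. q i m x\<bar> \<le> 2 ^ CARD('d)" for m x
    proof -
      have "\<bar>\<Prod>i\<in>UNIV. q i m x\<bar> = (\<Prod>i\<in>UNIV. \<bar>q i m x\<bar>)"
        by (rule abs_prod)
      also have "\<dots> \<le> (\<Prod>i\<in>(UNIV::'d set). 2)"
        using q(2) by (intro prod_mono) auto
      finally show ?thesis
        by simp
    qed
    fix x :: "real^'d"
    assume x: "x \<in> torus_cell \<Lambda>"
    have "(\<lambda>m. \<Prod>i\<in>UNIV. q i m x) \<longlonglongrightarrow> (\<Prod>i\<in>UNIV. if x $ i \<le> \<beta> $ i then 1 else 0)"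
      using q(3)[OF x] by (intro tendsto_prod) auto
    also have "(\<Prod>i\<in>UNIV. if x $ i \<le> \<beta> $ i then 1 else 0) = (indicator {..\<beta>} x :: real)"
      by (auto simp: indicator_def less_eq_vec_def)
    finally show "(\<lambda>m. \<Prod>i\<in>UNIV. q i m x) \<longlonglongrightarrow> indicator {..\<beta>} x" .
  qed
qed

section \<open>The fundamental lemma on the torus\<close>

lemma torus_cell_sets [measurable]: "torus_cell \<Lambda> \<in> sets borel"
proof -
  have "torus_cell \<Lambda> = (\<Inter>i\<in>UNIV. {x :: real^'a. 0 \<le> x $ i} \<inter> {x. x $ i < \<Lambda>})"
    by (auto simp: torus_cell_def)
  also have "\<dots> \<in> sets borel"
    by (intro sets.finite_INT sets.Int borel_closed borel_open closed_Collect_le open_Collect_less)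
      (auto intro!: continuous_intros)
  finally show ?thesis .
qed

lemma torus_cell_subset: "torus_cell \<Lambda> \<subseteq> cbox 0 (\<chi> i. \<Lambda>)"
  by (auto simp: torus_cell_def mem_box_cart less_imp_le)

lemma finite_measure_torus: "finite_measure (torus \<Lambda> :: (real^'d) measure)"
proof
  have "torus_cell \<Lambda> \<in> lmeasurable"
    using bounded_subset[OF bounded_cbox torus_cell_subset] torus_cell_sets
    by (intro bounded_set_imp_lmeasurable) auto
  then show "emeasure (torus \<Lambda>) (space (torus \<Lambda>)) \<noteq> \<infinity>"
    by (simp add: emeasure_restrict_space fmeasurable_def less_top)
qed

text \<open>The bound comes from compactness of the closed box around the half-open cell.\<close>

lemma torus_continuous_bounded:
  fixes \<phi> :: "real^'d \<Rightarrow> real"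
  assumes "continuous_on UNIV \<phi>"
  obtains B where "0 \<le> B" "\<And>x. x \<in> torus_cell \<Lambda> \<Longrightarrow> \<bar>\<phi> x\<bar> \<le> B"
proof -
  have "bounded (\<phi> ` cbox 0 (\<chi> i. \<Lambda>))"
    using assms by (intro compact_imp_bounded compact_continuous_image)
      (auto intro: continuous_on_subset)
  then obtain B where "\<And>x. x \<in> cbox 0 (\<chi> i. \<Lambda>) \<Longrightarrow> \<bar>\<phi> x\<bar> \<le> B"
    by (auto simp: bounded_iff)
  then show thesis
    using torus_cell_subset[of \<Lambda>] by (intro that[of "max 0 B"]) (auto intro: max.coboundedI2)
qed

lemma torus_continuous_measurable:
  fixes \<phi> :: "real^'d \<Rightarrow> real"
  assumes "continuous_on UNIV \<phi>"
  shows "\<phi> \<in> borel_measurable (torus \<Lambda>)"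
proof -
  have "\<phi> \<in> borel_measurable lebesgue"
    using borel_measurable_continuous_onI[OF assms] by (simp add: measurable_completion)
  then show ?thesis
    by (rule measurable_restrict_space1)
qed

lemma torus_integrable_mult_continuous:
  fixes g \<phi> :: "real^'d \<Rightarrow> real"
  assumes "integrable (torus \<Lambda>) g" "continuous_on UNIV \<phi>"
  shows "integrable (torus \<Lambda>) (\<lambda>x. g x * \<phi> x)"
proof -
  obtain B where B: "0 \<le> B" "\<And>x. x \<in> torus_cell \<Lambda> \<Longrightarrow> \<bar>\<phi> x\<bar> \<le> B"
    using torus_continuous_bounded[OF assms(2)] by metis
  show ?thesis
  proof (rule Bochner_Integration.integrable_bound)
    show "integrable (torus \<Lambda>) (\<lambda>x. B * g x)"
      using assms(1) by simp
    show "(\<lambda>x. g x * \<phi> x) \<in> borel_measurable (torus \<Lambda>)"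
      using assms torus_continuous_measurable by (intro borel_measurable_times) auto
    show "AE x in torus \<Lambda>. norm (g x * \<phi> x) \<le> norm (B * g x)"
      using B by (intro AE_I2) (auto simp: abs_mult mult.commute intro!: mult_right_mono)
  qed
qed

text \<open>Du Bois-Reymond: Dynkin's theorem extends the orthants, whose indicators are bounded
  pointwise limits of test functions, to all Borel sets.\<close>

lemma torus_fundamental_lemma:
  fixes g :: "real^'d \<Rightarrow> real"
  assumes "0 < \<Lambda>" and g: "integrable (torus \<Lambda>) g"
    and orth: "\<And>\<phi>. \<phi> \<in> periodic_smooth \<Lambda> \<Longrightarrow> (\<integral>x. g x * \<phi> x \<partial>torus \<Lambda>) = 0"
  shows "AE x in torus \<Lambda>. g x = 0"
proof -
  let ?I = "\<lambda>A. \<integral>x. g x * indicator A x \<partial>torus \<Lambda>"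
  have sets_borel: "A \<inter> torus_cell \<Lambda> \<in> sets (torus \<Lambda>)" if "A \<in> sets borel" for A :: "(real^'d) set"
    using that sets_completionI_sets[of "A \<inter> torus_cell \<Lambda>" lborel]
    by (simp add: sets_restrict_space_iff)
  have int: "integrable (torus \<Lambda>) (\<lambda>x. g x * indicator A x)" if "A \<in> sets borel"
    for A :: "(real^'d) set"
  proof -
    have "integrable (torus \<Lambda>) (\<lambda>x. indicator (A \<inter> torus_cell \<Lambda>) x *\<^sub>R g x)"
      using integrable_mult_indicator[OF sets_borel[OF that] g] .
    moreover have "integrable (torus \<Lambda>) (\<lambda>x. indicator (A \<inter> torus_cell \<Lambda>) x *\<^sub>R g x) \<longleftrightarrow>
        integrable (torus \<Lambda>) (\<lambda>x. g x * indicator A x)"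
      by (intro Bochner_Integration.integrable_cong) (auto simp: indicator_def)
    ultimately show ?thesis
      by blast
  qed
  have orthant: "?I {..\<beta>} = 0" for \<beta>
  proof -
    obtain q B where q: "\<And>m::nat. q m \<in> periodic_smooth \<Lambda>" "\<And>m x. \<bar>q m x\<bar> \<le> B"
        "\<And>x. x \<in> torus_cell \<Lambda> \<Longrightarrow> (\<lambda>m. q m x) \<longlonglongrightarrow> indicator {..\<beta>} x"
      using orthant_approximation[OF assms(1)] by metis
    have "(\<lambda>m. \<integral>x. g x * q m x \<partial>torus \<Lambda>) \<longlonglongrightarrow> ?I {..\<beta>}"
    proof (rule integral_dominated_convergence)
      show "integrable (torus \<Lambda>) (\<lambda>x. B * norm (g x))"
        using g by (intro integrable_mult_right integrable_norm)
      show "(\<lambda>x. g x * q m x) \<in> borel_measurable (torus \<Lambda>)" for m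
        using torus_integrable_mult_continuous[OF g periodic_smooth_continuous[OF q(1)]] by auto
      show "(\<lambda>x. g x * indicator {..\<beta>} x) \<in> borel_measurable (torus \<Lambda>)"
        using int[of "{..\<beta>}"] by (auto intro: borel_closed)
      show "AE x in torus \<Lambda>. (\<lambda>m. g x * q m x) \<longlonglongrightarrow> g x * indicator {..\<beta>} x"
        using q(3) by (intro AE_I2 tendsto_mult_left) auto
      show "AE x in torus \<Lambda>. norm (g x * q m x) \<le> B * norm (g x)" for m
        using mult_right_mono[OF q(2) abs_ge_zero]
        by (intro AE_I2) (simp add: abs_mult mult.commute)
    qed
    then show ?thesis
      using orth[OF q(1)] by (simp add: LIMSEQ_const_iff)
  qed
  have borel: "?I A = 0" if "A \<in> sets borel" for A
  proof -
    have "Int_stable (range (\<lambda>\<beta>::real^'d. {..\<beta>}))"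
      unfolding Int_stable_def
    proof safe
      fix a b :: "real^'d"
      have "{..a} \<inter> {..b} = {..inf a b}"
        by auto
      then show "{..a} \<inter> {..b} \<in> range atMost"
        by blast
    qed
    moreover have "range (\<lambda>\<beta>::real^'d. {..\<beta>}) \<subseteq> Pow UNIV"
      by simp
    moreover have "A \<in> sigma_sets UNIV (range (\<lambda>\<beta>::real^'d. {..\<beta>}))"
      using that unfolding borel_eq_atMost by simp
    ultimately show ?thesis
    proof (induction rule: sigma_sets_induct_disjoint)
      case (basic A)
      then show ?case
        using orthant by auto
    next
      case (compl A)
      have A: "A \<in> sets borel"
        using compl(1) unfolding borel_eq_atMost by simp
      \<comment> \<open>The constant 1 is a test function, so \<open>g\<close> has integral zero and
        the complement reduces to \<open>A\<close>.\<close>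
      have "?I (UNIV - A) = (\<integral>x. g x * 1 - g x * indicator A x \<partial>torus \<Lambda>)"
        by (intro Bochner_Integration.integral_cong) (auto simp: indicator_def)
      also have "\<dots> = 0"
        using g int[OF A] compl(2) orth[OF periodic_smooth_const[of 1]] by simp
      finally show ?case .
    next
      case (union A)
      have A: "A i \<in> sets borel" for i
        using union(2) unfolding borel_eq_atMost by auto
      have "(\<lambda>n. \<integral>x. g x * indicator (\<Union>i<n. A i) x \<partial>torus \<Lambda>) \<longlonglongrightarrow> ?I (\<Union>i. A i)"
      proof (rule integral_dominated_convergence)
        show "integrable (torus \<Lambda>) (\<lambda>x. norm (g x))"
          using g by simp
        show "AE x in torus \<Lambda>. (\<lambda>n. g x * indicator (\<Union>i<n. A i) x) \<longlonglongrightarrow> g x * indicator (\<Union>i. A i) x"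
          by (intro AE_I2 tendsto_mult_left LIMSEQ_indicator_UN)
        show "AE x in torus \<Lambda>. norm (g x * indicator (\<Union>i<n. A i) x) \<le> norm (g x)" for n
          by (auto simp: indicator_def)
      qed (use A int in \<open>auto intro!: borel_measurable_integrable\<close>)
      moreover have "(\<integral>x. g x * indicator (\<Union>i<n. A i) x \<partial>torus \<Lambda>) = 0" for n
      proof -
        have "(\<integral>x. g x * indicator (\<Union>i<n. A i) x \<partial>torus \<Lambda>) =
            (\<integral>x. (\<Sum>i<n. g x * indicator (A i) x) \<partial>torus \<Lambda>)"
          by (simp only: sum_distrib_left
            indicator_UN_disjoint[OF finite_lessThan disjoint_family_on_mono[OF subset_UNIV union(1)]])
        also have "\<dots> = (\<Sum>i<n. ?I (A i))"
          using A int by (intro Bochner_Integration.integral_sum) auto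
        finally show ?thesis
          using union(3) by simp
      qed
      ultimately show ?case
        by (simp add: LIMSEQ_const_iff)
    qed simp
  qed
  interpret finite_measure "torus \<Lambda> :: (real^'d) measure"
    by (rule finite_measure_torus)
  show ?thesis
  proof (rule density_zero[OF g])
    fix A
    assume asm: "A \<in> sets (torus \<Lambda> :: (real^'d) measure)"
    \<comment> \<open>Dynkin's theorem reaches Borel sets only. A Lebesgue measurable set is a Borel
      set \<open>S\<close> together with a part of a null set, and \<open>g\<close> has the same
      integral over both.\<close>
    then have "A \<in> sets (completion lborel)"
      by (auto simp: sets_restrict_space)
    then obtain S N N' where A: "A = S \<union> N" "N \<subseteq> N'" "N' \<in> null_sets lborel" "S \<in> sets borel"
      by (auto elim: sets_completionE)
    have "AE x in lebesgue. x \<notin> N'"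
      using AE_not_in[OF A(3)] by (rule AE_completion)
    then have "AE x in lebesgue. x \<in> torus_cell \<Lambda> \<longrightarrow> x \<notin> N'"
      by eventually_elim simp
    then have ae: "AE x in torus \<Lambda>. x \<notin> N'"
      by (simp add: AE_restrict_space_iff)
    have "set_lebesgue_integral (torus \<Lambda>) A g = ?I S"
      unfolding set_lebesgue_integral_def
    proof (rule integral_cong_AE)
      show "(\<lambda>x. indicator A x *\<^sub>R g x) \<in> borel_measurable (torus \<Lambda>)"
        using integrable_mult_indicator[OF asm g] by simp
      show "(\<lambda>x. g x * indicator S x) \<in> borel_measurable (torus \<Lambda>)"
        using int[OF A(4)] by simp
      show "AE x in torus \<Lambda>. indicator A x *\<^sub>R g x = g x * indicator S x"
        using ae by eventually_elim (use A in \<open>auto simp: indicator_def\<close>)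
    qed
    also have "\<dots> = 0"
      using A(4) by (rule borel)
    finally show "set_lebesgue_integral (torus \<Lambda>) A g = 0" .
  qed
qed

section \<open>Weak gradients\<close>

lemma L2_torus_iff: "u \<in> L2_torus \<Lambda> \<longleftrightarrow> square_integrable (torus \<Lambda>) u"
  by (simp add: L2_torus_def square_integrable_def)

lemmas L2_torus_integrable = square_integrable_integrable[OF finite_measure_torus]

lemma torus_continuous_square_integrable:
  fixes \<phi> :: "real^'d \<Rightarrow> real"
  assumes "continuous_on UNIV \<phi>"
  shows "square_integrable (torus \<Lambda>) \<phi>"
proof -
  obtain B where "\<And>x. x \<in> torus_cell \<Lambda> \<Longrightarrow> \<bar>\<phi> x\<bar> \<le> B"
    using torus_continuous_bounded[OF assms] by metis
  then show ?thesis
    using square_integrable_bounded[OF finite_measure_torus torus_continuous_measurable[OF assms]]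
    by auto
qed

lemma torus_square_integrable_mult_continuous:
  fixes u \<phi> :: "real^'d \<Rightarrow> real"
  assumes "square_integrable (torus \<Lambda>) u" "continuous_on UNIV \<phi>"
  shows "integrable (torus \<Lambda>) (\<lambda>x. u x * \<phi> x)"
  using torus_integrable_mult_continuous[OF L2_torus_integrable[OF assms(1)] assms(2)] .

lemma has_weak_gradient_square_integrable:
  "has_weak_gradient \<Lambda> u g \<Longrightarrow> square_integrable (torus \<Lambda>) g"
  by (simp add: has_weak_gradient_def L2_torus_iff square_integrable_vec)

lemma has_weak_gradient_linear:
  fixes u v :: "real^'d \<Rightarrow> real"
  assumes u: "u \<in> L2_torus \<Lambda>" "has_weak_gradient \<Lambda> u g"
    and v: "v \<in> L2_torus \<Lambda>" "has_weak_gradient \<Lambda> v k"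
  shows "has_weak_gradient \<Lambda> (\<lambda>x. s * u x + t * v x) (\<lambda>x. s *\<^sub>R g x + t *\<^sub>R k x)"
  unfolding has_weak_gradient_def
proof (intro allI conjI ballI)
  fix i
  have gk: "square_integrable (torus \<Lambda>) (\<lambda>x. g x $ i)" "square_integrable (torus \<Lambda>) (\<lambda>x. k x $ i)"
    using u v by (auto simp: has_weak_gradient_def L2_torus_iff)
  then show "(\<lambda>x. (s *\<^sub>R g x + t *\<^sub>R k x) $ i) \<in> L2_torus \<Lambda>"
    using square_integrable_add[OF square_integrable_scaleR[OF gk(1)] square_integrable_scaleR[OF gk(2)]]
    by (simp add: L2_torus_iff)
  fix \<phi> :: "real^'d \<Rightarrow> real"
  assume \<phi>: "\<phi> \<in> periodic_smooth \<Lambda>"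
  have int: "integrable (torus \<Lambda>) (\<lambda>x. u x * partial_deriv i \<phi> x)"
      "integrable (torus \<Lambda>) (\<lambda>x. v x * partial_deriv i \<phi> x)"
      "integrable (torus \<Lambda>) (\<lambda>x. g x $ i * \<phi> x)" "integrable (torus \<Lambda>) (\<lambda>x. k x $ i * \<phi> x)"
    using u(1) v(1) gk periodic_smooth_continuous[OF \<phi>] periodic_smooth_partial_deriv_continuous[OF \<phi>]
    by (auto simp: L2_torus_iff intro!: torus_square_integrable_mult_continuous)
  have "(\<integral>x. (s * u x + t * v x) * partial_deriv i \<phi> x \<partial>torus \<Lambda>) =
      (\<integral>x. s * (u x * partial_deriv i \<phi> x) + t * (v x * partial_deriv i \<phi> x) \<partial>torus \<Lambda>)"
    by (simp add: algebra_simps)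
  also have "\<dots> = s * (- (\<integral>x. g x $ i * \<phi> x \<partial>torus \<Lambda>)) + t * (- (\<integral>x. k x $ i * \<phi> x \<partial>torus \<Lambda>))"
    using int u(2) v(2) \<phi> by (simp add: has_weak_gradient_def)
  also have "\<dots> = - (\<integral>x. s * (g x $ i * \<phi> x) + t * (k x $ i * \<phi> x) \<partial>torus \<Lambda>)"
    using int by simp
  also have "(\<integral>x. s * (g x $ i * \<phi> x) + t * (k x $ i * \<phi> x) \<partial>torus \<Lambda>) =
      (\<integral>x. (s *\<^sub>R g x + t *\<^sub>R k x) $ i * \<phi> x \<partial>torus \<Lambda>)"
    by (simp add: algebra_simps)
  finally show "(\<integral>x. (s * u x + t * v x) * partial_deriv i \<phi> x \<partial>torus \<Lambda>) =
      - (\<integral>x. (s *\<^sub>R g x + t *\<^sub>R k x) $ i * \<phi> x \<partial>torus \<Lambda>)" .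
qed

text \<open>Each component of the difference integrates to zero against every test function, so the
  fundamental lemma applies componentwise.\<close>

lemma has_weak_gradient_unique:
  fixes u :: "real^'d \<Rightarrow> real"
  assumes "0 < \<Lambda>" and g: "has_weak_gradient \<Lambda> u g" and k: "has_weak_gradient \<Lambda> u k"
  shows "AE x in torus \<Lambda>. g x = k x"
proof -
  have "AE x in torus \<Lambda>. g x $ i - k x $ i = 0" for i
  proof (rule torus_fundamental_lemma[OF assms(1)])
    have sq: "square_integrable (torus \<Lambda>) (\<lambda>x. g x $ i)" "square_integrable (torus \<Lambda>) (\<lambda>x. k x $ i)"
      using g k by (auto simp: has_weak_gradient_def L2_torus_iff)
    then show "integrable (torus \<Lambda>) (\<lambda>x. g x $ i - k x $ i)"
      by (intro Bochner_Integration.integrable_diff L2_torus_integrable)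
    fix \<phi> :: "real^'d \<Rightarrow> real"
    assume \<phi>: "\<phi> \<in> periodic_smooth \<Lambda>"
    have "integrable (torus \<Lambda>) (\<lambda>x. g x $ i * \<phi> x)" "integrable (torus \<Lambda>) (\<lambda>x. k x $ i * \<phi> x)"
      using sq periodic_smooth_continuous[OF \<phi>]
      by (auto intro!: torus_square_integrable_mult_continuous)
    moreover have "(\<integral>x. g x $ i * \<phi> x \<partial>torus \<Lambda>) = (\<integral>x. k x $ i * \<phi> x \<partial>torus \<Lambda>)"
    proof -
      have "- (\<integral>x. g x $ i * \<phi> x \<partial>torus \<Lambda>) = (\<integral>x. u x * partial_deriv i \<phi> x \<partial>torus \<Lambda>)"
          "- (\<integral>x. k x $ i * \<phi> x \<partial>torus \<Lambda>) = (\<integral>x. u x * partial_deriv i \<phi> x \<partial>torus \<Lambda>)"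
        using g k \<phi> by (simp_all add: has_weak_gradient_def)
      then show ?thesis
        by linarith
    qed
    ultimately show "(\<integral>x. (g x $ i - k x $ i) * \<phi> x \<partial>torus \<Lambda>) = 0"
      by (simp add: left_diff_distrib)
  qed
  then have "AE x in torus \<Lambda>. \<forall>i\<in>UNIV. g x $ i - k x $ i = 0"
    by (intro AE_finite_allI) auto
  then show ?thesis
    by eventually_elim (simp add: vec_eq_iff)
qed

lemma H1_torus_weak_gradient: "u \<in> H1_torus \<Lambda> \<Longrightarrow> has_weak_gradient \<Lambda> u (weak_gradient \<Lambda> u)"
  unfolding H1_torus_def weak_gradient_def by (simp add: some_eq_ex[of "has_weak_gradient \<Lambda> u"])

lemma H1_torus_L2: "u \<in> H1_torus \<Lambda> \<Longrightarrow> square_integrable (torus \<Lambda>) u"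
  by (simp add: H1_torus_def L2_torus_iff)

lemma H1_torus_weak_gradient_L2:
  "u \<in> H1_torus \<Lambda> \<Longrightarrow> square_integrable (torus \<Lambda>) (weak_gradient \<Lambda> u)"
  by (rule has_weak_gradient_square_integrable[OF H1_torus_weak_gradient])

text \<open>The chosen representatives need not subtract pointwise. Their difference is nevertheless
  a weak gradient of the difference, and uniqueness compares it with the chosen one.\<close>

lemma H1_torus_diff:
  assumes "0 < \<Lambda>" and u: "u \<in> H1_torus \<Lambda>" and v: "v \<in> H1_torus \<Lambda>"
  shows "(\<lambda>x. u x - v x) \<in> H1_torus \<Lambda>"
    and "AE x in torus \<Lambda>. weak_gradient \<Lambda> (\<lambda>x. u x - v x) x = weak_gradient \<Lambda> u x - weak_gradient \<Lambda> v x"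
proof -
  have d: "has_weak_gradient \<Lambda> (\<lambda>x. u x - v x) (\<lambda>x. weak_gradient \<Lambda> u x - weak_gradient \<Lambda> v x)"
    using has_weak_gradient_linear[of u \<Lambda> _ v _ 1 "-1"] H1_torus_weak_gradient[OF u]
      H1_torus_weak_gradient[OF v] u v by (simp add: H1_torus_def)
  then show h: "(\<lambda>x. u x - v x) \<in> H1_torus \<Lambda>"
    using square_integrable_diff[OF H1_torus_L2[OF u] H1_torus_L2[OF v]]
    by (auto simp: H1_torus_def L2_torus_iff)
  show "AE x in torus \<Lambda>. weak_gradient \<Lambda> (\<lambda>x. u x - v x) x = weak_gradient \<Lambda> u x - weak_gradient \<Lambda> v x"
    using has_weak_gradient_unique[OF assms(1) H1_torus_weak_gradient[OF h] d] .
qed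

section \<open>The Helmholtz equation\<close>

text \<open>The weighted pairs \<open>(\<surd>c u, \<nabla>u)\<close> with \<open>u\<close> in \<open>H\<^sup>1\<close> form a closed subspace of \<open>L\<^sup>2\<close>, being the
  annihilator of the pairs \<open>(\<partial>\<^sub>i\<phi> / \<surd>c, \<phi> e\<^sub>i)\<close>. The weak solution is the first component of the
  orthogonal projection of \<open>(\<surd>c f, 0)\<close> onto it.\<close>

lemma helmholtz_weak_solution_exists:
  fixes f :: "real^'d \<Rightarrow> real"
  assumes "0 < \<Lambda>" "0 < c" and f: "f \<in> L2_torus \<Lambda>"
  shows "\<exists>w. helmholtz_weak_solution \<Lambda> c f w"
proof -
  define test :: "'d \<Rightarrow> (real^'d \<Rightarrow> real) \<Rightarrow> real^'d \<Rightarrow> real \<times> (real^'d)"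
    where "test i \<phi> x = (partial_deriv i \<phi> x / sqrt c, \<phi> x *\<^sub>R axis i 1)" for i \<phi> x
  define S where "S = {U. square_integrable (torus \<Lambda>) U \<and>
    (\<forall>i. \<forall>\<phi>\<in>periodic_smooth \<Lambda>. (\<integral>x. U x \<bullet> test i \<phi> x \<partial>torus \<Lambda>) = 0)}"
  have sqrt_c: "0 < sqrt c" "sqrt c * sqrt c = c"
    using assms(2) by simp_all
  have test: "square_integrable (torus \<Lambda>) (test i \<phi>)" if \<phi>: "\<phi> \<in> periodic_smooth \<Lambda>" for i \<phi>
  proof -
    have "square_integrable (torus \<Lambda>) (\<lambda>x. partial_deriv i \<phi> x / sqrt c)"
      using periodic_smooth_partial_deriv_continuous[OF \<phi>] assms(2)
      by (intro torus_continuous_square_integrable continuous_intros) auto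
    moreover have "square_integrable (torus \<Lambda>) (\<lambda>x. \<phi> x *\<^sub>R axis i (1::real))"
      unfolding square_integrable_vec using periodic_smooth_continuous[OF \<phi>]
      by (intro allI torus_continuous_square_integrable) (auto intro!: continuous_intros)
    ultimately show ?thesis
      unfolding test_def by (simp add: square_integrable_Pair)
  qed
  \<comment> \<open>The factor \<open>sqrt c\<close> on \<open>u\<close> cancels the one in the
    denominator of \<open>test\<close>, so orthogonality to \<open>test i \<phi>\<close> is exactly
    the integration by parts formula for the \<open>i\<close>-th component.\<close>
  have S_iff: "(\<lambda>x. (sqrt c * u x, g x)) \<in> S \<longleftrightarrow> u \<in> L2_torus \<Lambda> \<and> has_weak_gradient \<Lambda> u g" for u g
  proof -
    have "square_integrable (torus \<Lambda>) (\<lambda>x. sqrt c * u x) \<longleftrightarrow> square_integrable (torus \<Lambda>) u"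
      using square_integrable_scaleR[of "torus \<Lambda>" u "sqrt c"] sqrt_c
        square_integrable_scaleR[of "torus \<Lambda>" "\<lambda>x. sqrt c * u x" "1 / sqrt c"] by auto
    then have sq: "square_integrable (torus \<Lambda>) (\<lambda>x. (sqrt c * u x, g x)) \<longleftrightarrow>
        u \<in> L2_torus \<Lambda> \<and> (\<forall>i. (\<lambda>x. g x $ i) \<in> L2_torus \<Lambda>)"
      by (simp add: square_integrable_Pair square_integrable_vec L2_torus_iff)
    have "(\<integral>x. (sqrt c * u x, g x) \<bullet> test i \<phi> x \<partial>torus \<Lambda>) =
        (\<integral>x. u x * partial_deriv i \<phi> x \<partial>torus \<Lambda>) + (\<integral>x. g x $ i * \<phi> x \<partial>torus \<Lambda>)"
      if u: "u \<in> L2_torus \<Lambda>" "(\<lambda>x. g x $ i) \<in> L2_torus \<Lambda>" and \<phi>: "\<phi> \<in> periodic_smooth \<Lambda>" for i \<phi>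
    proof -
      have "(sqrt c * u x, g x) \<bullet> test i \<phi> x = u x * partial_deriv i \<phi> x + g x $ i * \<phi> x" for x
        using assms(2) by (simp add: test_def inner_axis)
      moreover have "integrable (torus \<Lambda>) (\<lambda>x. u x * partial_deriv i \<phi> x)"
          "integrable (torus \<Lambda>) (\<lambda>x. g x $ i * \<phi> x)"
        using u periodic_smooth_continuous[OF \<phi>] periodic_smooth_partial_deriv_continuous[OF \<phi>]
        by (auto simp: L2_torus_iff intro!: torus_square_integrable_mult_continuous)
      ultimately show ?thesis
        by simp
    qed
    then show ?thesis
      unfolding S_def has_weak_gradient_def by (auto simp: sq add_eq_0_iff2)
  qed
  have sq_f: "square_integrable (torus \<Lambda>) (\<lambda>x. (sqrt c * f x, 0 :: real^'d))"
    using square_integrable_scaleR[of "torus \<Lambda>" f "sqrt c"] f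
    by (simp add: square_integrable_Pair L2_torus_iff square_integrable_def[of _ "\<lambda>_. 0"])
  obtain U where U: "U \<in> S" "\<And>V. V \<in> S \<Longrightarrow> (\<integral>x. (U x - (sqrt c * f x, 0)) \<bullet> V x \<partial>torus \<Lambda>) = 0"
  proof (rule square_integrable_orthogonal_projection[OF finite_measure_torus sq_f, of S])
    show "(\<lambda>x. s *\<^sub>R u x + t *\<^sub>R v x) \<in> S" if "u \<in> S" "v \<in> S" for u v s t
    proof -
      have "(\<integral>x. (s *\<^sub>R u x + t *\<^sub>R v x) \<bullet> test i \<phi> x \<partial>torus \<Lambda>) = 0"
        if "\<phi> \<in> periodic_smooth \<Lambda>" for i \<phi>
        using square_integrable_inner[OF _ test[OF that]] \<open>u \<in> S\<close> \<open>v \<in> S\<close> that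
        by (simp add: S_def inner_add_left)
      then show ?thesis
        using that by (auto simp: S_def intro!: square_integrable_add square_integrable_scaleR)
    qed
    show "v \<in> S" if "\<And>n. u n \<in> S" "square_integrable (torus \<Lambda>) v"
        "(\<lambda>n::nat. \<integral>x. (norm (u n x - v x))\<^sup>2 \<partial>torus \<Lambda>) \<longlonglongrightarrow> 0" for u v
    proof -
      have "(\<integral>x. v x \<bullet> test i \<phi> x \<partial>torus \<Lambda>) = 0" if \<phi>: "\<phi> \<in> periodic_smooth \<Lambda>" for i \<phi>
        using square_integrable_tendsto_inner[of "torus \<Lambda>" u v "test i \<phi>"] \<open>\<And>n. u n \<in> S\<close> that(1)
          \<open>square_integrable (torus \<Lambda>) v\<close> test[OF \<phi>]
          \<open>(\<lambda>n::nat. \<integral>x. (norm (u n x - v x))\<^sup>2 \<partial>torus \<Lambda>) \<longlonglongrightarrow> 0\<close>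
        by (simp add: S_def LIMSEQ_const_iff)
      then show ?thesis
        using that by (simp add: S_def)
    qed
  qed (auto simp: S_def square_integrable_def)
  define w where "w x = fst (U x) / sqrt c" for x
  have U_eq: "U = (\<lambda>x. (sqrt c * w x, snd (U x)))"
    using sqrt_c by (auto simp: w_def)
  have w: "w \<in> L2_torus \<Lambda>" "has_weak_gradient \<Lambda> w (\<lambda>x. snd (U x))"
    using S_iff[of w "\<lambda>x. snd (U x)"] U(1) U_eq by auto
  then have wH: "w \<in> H1_torus \<Lambda>"
    by (auto simp: H1_torus_def)
  \<comment> \<open>The projection yields some weak gradient of \<open>w\<close>, whereas the weak
    formulation refers to the chosen one.\<close>
  have ae: "AE x in torus \<Lambda>. weak_gradient \<Lambda> w x = snd (U x)"
    using has_weak_gradient_unique[OF assms(1) H1_torus_weak_gradient[OF wH] w(2)] .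
  have "c * (\<integral>x. w x * v x \<partial>torus \<Lambda>) + (\<integral>x. weak_gradient \<Lambda> w x \<bullet> weak_gradient \<Lambda> v x \<partial>torus \<Lambda>) =
      c * (\<integral>x. f x * v x \<partial>torus \<Lambda>)" if v: "v \<in> H1_torus \<Lambda>" for v
  proof -
    have sq: "square_integrable (torus \<Lambda>) w" "square_integrable (torus \<Lambda>) v"
        "square_integrable (torus \<Lambda>) f"
        "square_integrable (torus \<Lambda>) (weak_gradient \<Lambda> w)" "square_integrable (torus \<Lambda>) (weak_gradient \<Lambda> v)"
      using wH v f[unfolded L2_torus_iff] by (simp_all add: H1_torus_L2 H1_torus_weak_gradient_L2)
    have int: "integrable (torus \<Lambda>) (\<lambda>x. w x * v x)" "integrable (torus \<Lambda>) (\<lambda>x. f x * v x)"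
        "integrable (torus \<Lambda>) (\<lambda>x. weak_gradient \<Lambda> w x \<bullet> weak_gradient \<Lambda> v x)"
      using square_integrable_inner[OF sq(1,2)] square_integrable_inner[OF sq(3,2)]
        square_integrable_inner[OF sq(4,5)] by simp_all
    have V: "(\<lambda>x. (sqrt c * v x, weak_gradient \<Lambda> v x)) \<in> S"
      using S_iff H1_torus_weak_gradient[OF v] v by (simp add: H1_torus_def)
    have sqU: "square_integrable (torus \<Lambda>) (\<lambda>x. U x - (sqrt c * f x, 0))"
      using U(1) sq_f by (intro square_integrable_diff) (simp_all add: S_def)
    \<comment> \<open>Expanding this inner product gives the weak equation: the value components
      contribute the coefficient \<open>c\<close>, and the zero second component of the datum leaves
      the gradient term untouched.\<close>
    have "0 = (\<integral>x. (U x - (sqrt c * f x, 0)) \<bullet> (sqrt c * v x, weak_gradient \<Lambda> v x) \<partial>torus \<Lambda>)"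
      using U(2)[OF V] by simp
    also have "\<dots> = (\<integral>x. c * (w x * v x) - c * (f x * v x) + weak_gradient \<Lambda> w x \<bullet> weak_gradient \<Lambda> v x \<partial>torus \<Lambda>)"
    proof (rule integral_cong_AE)
      show "(\<lambda>x. (U x - (sqrt c * f x, 0)) \<bullet> (sqrt c * v x, weak_gradient \<Lambda> v x)) \<in> borel_measurable (torus \<Lambda>)"
        using square_integrable_inner[OF sqU, of "\<lambda>x. (sqrt c * v x, weak_gradient \<Lambda> v x)"] V
        by (simp add: S_def)
      show "AE x in torus \<Lambda>. (U x - (sqrt c * f x, 0)) \<bullet> (sqrt c * v x, weak_gradient \<Lambda> v x) =
          c * (w x * v x) - c * (f x * v x) + weak_gradient \<Lambda> w x \<bullet> weak_gradient \<Lambda> v x"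
        using ae
      proof eventually_elim
        case (elim x)
        have "U x = (sqrt c * w x, weak_gradient \<Lambda> w x)"
          using U_eq elim by metis
        moreover have "(sqrt c * w x - sqrt c * f x) * (sqrt c * v x) = (sqrt c * sqrt c) * ((w x - f x) * v x)"
          by (simp only: algebra_simps)
        ultimately show ?case
          using sqrt_c(2) by (simp add: algebra_simps)
      qed
    qed (use int in auto)
    also have "\<dots> = c * (\<integral>x. w x * v x \<partial>torus \<Lambda>) - c * (\<integral>x. f x * v x \<partial>torus \<Lambda>)
        + (\<integral>x. weak_gradient \<Lambda> w x \<bullet> weak_gradient \<Lambda> v x \<partial>torus \<Lambda>)"
      using int by simp
    finally show ?thesis
      by simp
  qed
  then show ?thesis
    using wH unfolding helmholtz_weak_solution_def by blast
qed

section \<open>The exact energy gap and the unique minimizer\<close>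

lemma J_functional_weak_solution:
  assumes "0 < \<Lambda>" and f: "f \<in> L2_torus \<Lambda>"
    and w: "helmholtz_weak_solution \<Lambda> (helmholtz_coeff \<alpha> h) f w" and v: "v \<in> H1_torus \<Lambda>"
  shows "J_functional \<Lambda> \<alpha> h f v = J_functional \<Lambda> \<alpha> h f w
    + 1 / 2 * (\<integral>x. (norm (weak_gradient \<Lambda> (\<lambda>x. v x - w x) x))\<^sup>2 \<partial>torus \<Lambda>)
    + helmholtz_coeff \<alpha> h / 2 * (\<integral>x. (v x - w x)\<^sup>2 \<partial>torus \<Lambda>)"
proof -
  define c where "c = helmholtz_coeff \<alpha> h"
  have J: "J_functional \<Lambda> \<alpha> h f u = 1 / 2 * (\<integral>x. (norm (weak_gradient \<Lambda> u x))\<^sup>2 \<partial>torus \<Lambda>)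
      + c / 2 * (\<integral>x. (u x - f x)\<^sup>2 \<partial>torus \<Lambda>)" for u
    by (simp add: J_functional_def c_def helmholtz_coeff_def)
  define z where "z x = v x - w x" for x
  have wH: "w \<in> H1_torus \<Lambda>"
    using w by (simp add: helmholtz_weak_solution_def)
  have zH: "z \<in> H1_torus \<Lambda>"
    and ae: "AE x in torus \<Lambda>. weak_gradient \<Lambda> z x = weak_gradient \<Lambda> v x - weak_gradient \<Lambda> w x"
    using H1_torus_diff[OF assms(1) v wH] unfolding z_def[abs_def] by auto
  have sq: "square_integrable (torus \<Lambda>) u" "square_integrable (torus \<Lambda>) (weak_gradient \<Lambda> u)"
    if "u \<in> H1_torus \<Lambda>" for u
    using that by (simp_all add: H1_torus_L2 H1_torus_weak_gradient_L2)
  have sqf: "square_integrable (torus \<Lambda>) f"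
    using f by (simp add: L2_torus_iff)
  have int_grad: "integrable (torus \<Lambda>) (\<lambda>x. (norm (weak_gradient \<Lambda> u x))\<^sup>2)" if "u \<in> H1_torus \<Lambda>" for u
    using sq(2)[OF that] by (rule square_integrable_norm)
  have int: "integrable (torus \<Lambda>) (\<lambda>x. weak_gradient \<Lambda> w x \<bullet> weak_gradient \<Lambda> z x)"
      "integrable (torus \<Lambda>) (\<lambda>x. w x * z x)" "integrable (torus \<Lambda>) (\<lambda>x. f x * z x)"
      "integrable (torus \<Lambda>) (\<lambda>x. (z x)\<^sup>2)" "integrable (torus \<Lambda>) (\<lambda>x. (w x - f x)\<^sup>2)"
    using square_integrable_inner[OF sq(2)[OF wH] sq(2)[OF zH]]
      square_integrable_inner[OF sq(1)[OF wH] sq(1)[OF zH]]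
      square_integrable_inner[OF sqf sq(1)[OF zH]]
      square_integrable_norm[OF sq(1)[OF zH]]
      square_integrable_norm[OF square_integrable_diff[OF sq(1)[OF wH] sqf]] by simp_all
  \<comment> \<open>The gradient of \<open>v\<close> splits into those of \<open>w\<close> and
    \<open>z\<close> only almost everywhere, unlike the expansion of the zero-order term below,
    which is pointwise.\<close>
  have "(\<integral>x. (norm (weak_gradient \<Lambda> v x))\<^sup>2 \<partial>torus \<Lambda>) =
      (\<integral>x. (norm (weak_gradient \<Lambda> w x))\<^sup>2 + 2 * (weak_gradient \<Lambda> w x \<bullet> weak_gradient \<Lambda> z x)
        + (norm (weak_gradient \<Lambda> z x))\<^sup>2 \<partial>torus \<Lambda>)"
  proof (rule integral_cong_AE)
    show "AE x in torus \<Lambda>. (norm (weak_gradient \<Lambda> v x))\<^sup>2 =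
        (norm (weak_gradient \<Lambda> w x))\<^sup>2 + 2 * (weak_gradient \<Lambda> w x \<bullet> weak_gradient \<Lambda> z x)
          + (norm (weak_gradient \<Lambda> z x))\<^sup>2"
      using ae
    proof eventually_elim
      case (elim x)
      then have "weak_gradient \<Lambda> v x = weak_gradient \<Lambda> w x + weak_gradient \<Lambda> z x"
        by simp
      then show ?case
        by (simp add: power2_norm_eq_inner inner_add_left inner_add_right inner_commute)
    qed
  qed (use int int_grad[OF v] int_grad[OF wH] int_grad[OF zH] in \<open>auto intro!: borel_measurable_integrable\<close>)
  also have "\<dots> = (\<integral>x. (norm (weak_gradient \<Lambda> w x))\<^sup>2 \<partial>torus \<Lambda>)
      + 2 * (\<integral>x. weak_gradient \<Lambda> w x \<bullet> weak_gradient \<Lambda> z x \<partial>torus \<Lambda>)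
      + (\<integral>x. (norm (weak_gradient \<Lambda> z x))\<^sup>2 \<partial>torus \<Lambda>)"
    using int int_grad[OF wH] int_grad[OF zH] by simp
  finally have grad: "(\<integral>x. (norm (weak_gradient \<Lambda> v x))\<^sup>2 \<partial>torus \<Lambda>) = \<dots>" .
  have "(v x - f x)\<^sup>2 = (w x - f x)\<^sup>2 + 2 * (w x * z x) - 2 * (f x * z x) + (z x)\<^sup>2" for x
    by (simp add: z_def power2_eq_square algebra_simps)
  then have fid: "(\<integral>x. (v x - f x)\<^sup>2 \<partial>torus \<Lambda>) = (\<integral>x. (w x - f x)\<^sup>2 \<partial>torus \<Lambda>)
      + 2 * (\<integral>x. w x * z x \<partial>torus \<Lambda>) - 2 * (\<integral>x. f x * z x \<partial>torus \<Lambda>) + (\<integral>x. (z x)\<^sup>2 \<partial>torus \<Lambda>)"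
    using int by simp
  have "c * (\<integral>x. w x * z x \<partial>torus \<Lambda>) + (\<integral>x. weak_gradient \<Lambda> w x \<bullet> weak_gradient \<Lambda> z x \<partial>torus \<Lambda>) =
      c * (\<integral>x. f x * z x \<partial>torus \<Lambda>)"
    using w zH by (simp add: helmholtz_weak_solution_def c_def)
  then have "J_functional \<Lambda> \<alpha> h f v = J_functional \<Lambda> \<alpha> h f w
    + 1 / 2 * (\<integral>x. (norm (weak_gradient \<Lambda> z x))\<^sup>2 \<partial>torus \<Lambda>) + c / 2 * (\<integral>x. (z x)\<^sup>2 \<partial>torus \<Lambda>)"
    unfolding J grad fid by (simp add: algebra_simps)
  then show ?thesis
    unfolding c_def z_def[abs_def] .
qed

text \<open>Both terms of the energy gap are nonnegative, which gives minimality. If a competitor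
  ties, the zero-order term vanishes, and its positive coefficient forces equality almost
  everywhere; the gradient term alone could not separate functions that differ by a
  constant.\<close>

lemma helmholtz_weak_solution_unique_minimizer:
  assumes "0 < \<Lambda>" "0 < helmholtz_coeff \<alpha> h" and f: "f \<in> L2_torus \<Lambda>"
    and w: "helmholtz_weak_solution \<Lambda> (helmholtz_coeff \<alpha> h) f w"
  shows "is_unique_H1_minimizer \<Lambda> (J_functional \<Lambda> \<alpha> h f) w"
proof -
  note J = J_functional_weak_solution[OF assms(1) f w]
  have wH: "w \<in> H1_torus \<Lambda>"
    using w by (simp add: helmholtz_weak_solution_def)
  have nonneg: "0 \<le> (\<integral>x. (norm (weak_gradient \<Lambda> (\<lambda>x. v x - w x) x))\<^sup>2 \<partial>torus \<Lambda>)"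
    "0 \<le> (\<integral>x. (v x - w x)\<^sup>2 \<partial>torus \<Lambda>)" for v
    by simp_all
  have "J_functional \<Lambda> \<alpha> h f w \<le> J_functional \<Lambda> \<alpha> h f v" if "v \<in> H1_torus \<Lambda>" for v
    unfolding J[OF that] using nonneg[of v] assms(2) by simp
  moreover have "AE x in torus \<Lambda>. v x = w x"
    if v: "v \<in> H1_torus \<Lambda>" and le: "J_functional \<Lambda> \<alpha> h f v \<le> J_functional \<Lambda> \<alpha> h f w" for v
  proof -
    have "helmholtz_coeff \<alpha> h / 2 * (\<integral>x. (v x - w x)\<^sup>2 \<partial>torus \<Lambda>) \<le> 0"
      using le nonneg(1)[of v] unfolding J[OF v] by linarith
    then have "(\<integral>x. (v x - w x)\<^sup>2 \<partial>torus \<Lambda>) = 0"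
      using nonneg(2)[of v] assms(2) by (simp add: mult_le_0_iff)
    moreover have "integrable (torus \<Lambda>) (\<lambda>x. (v x - w x)\<^sup>2)"
      using square_integrable_norm[OF square_integrable_diff[OF H1_torus_L2[OF v] H1_torus_L2[OF wH]]]
      by simp
    ultimately show ?thesis
      by (subst (asm) integral_nonneg_eq_0_iff_AE) auto
  qed
  ultimately show ?thesis
    using wH unfolding is_unique_H1_minimizer_def is_H1_minimizer_def by blast
qed

section \<open>Square integrability of the history average\<close>

lemma Linf_binary_subset_L2: "Linf_binary \<Lambda> \<subseteq> (L2_torus \<Lambda> :: (real^'d \<Rightarrow> real) set)"
proof
  fix u :: "real^'d \<Rightarrow> real"
  assume u: "u \<in> Linf_binary \<Lambda>"
  interpret finite_measure "torus \<Lambda> :: (real^'d) measure"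
    by (rule finite_measure_torus)
  have m: "u \<in> borel_measurable (torus \<Lambda>)" and ae: "AE x in torus \<Lambda>. u x \<in> {0, 1}"
    using u by (auto simp: Linf_binary_def)
  have "AE x in torus \<Lambda>. norm ((u x)\<^sup>2) \<le> 1"
    using ae by eventually_elim auto
  then show "u \<in> L2_torus \<Lambda>"
    using m by (auto simp: L2_torus_def intro!: integrable_const_bound[of _ 1])
qed

lemma L1_history_L2:
  fixes chi :: "nat \<Rightarrow> real^'d \<Rightarrow> real"
  assumes "\<And>k. k \<le> m \<Longrightarrow> chi k \<in> L2_torus \<Lambda>"
  shows "L1_history \<alpha> chi m \<in> L2_torus \<Lambda>"
proof -
  have chi: "square_integrable (torus \<Lambda>) (\<lambda>x. a * chi k x)" if "k \<le> m" for a k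
    using square_integrable_scaleR[of "torus \<Lambda>" "chi k" a] assms[OF that] by (simp add: L2_torus_iff)
  \<comment> \<open>Keeping the index set inside \<open>{1..m}\<close> through the induction
    matters: \<open>1 \<le> j\<close> is what gives \<open>m + 1 - j \<le> m\<close>, so that the
    hypothesis on the states applies.\<close>
  have sum: "square_integrable (torus \<Lambda>) (\<lambda>x. \<Sum>j\<in>I. a j * chi (m + 1 - j) x)"
    if "finite I" "I \<subseteq> {1..m}" for I a
    using that
  proof (induction I rule: finite_induct)
    case empty
    show ?case
      by (simp add: square_integrable_def)
  next
    case (insert j I)
    then have "m + 1 - j \<le> m"
      by auto
    then show ?case
      using insert square_integrable_add[OF chi] by auto
  qed
  show ?thesis
    unfolding L2_torus_iff L1_history_def[abs_def]
    by (intro square_integrable_add sum chi) auto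
qed

text \<open>Existence is part of the conclusion, so the statement about weak solutions is not
  vacuous. Their uniqueness almost everywhere is implied by the second part, since any two of them
  minimise the same functional.\<close>

theorem proposition3p2:
  fixes \<Lambda> \<alpha> h :: real and n :: nat and chi :: "nat \<Rightarrow> real^'d \<Rightarrow> real"
  assumes "0 < \<Lambda>" and "0 < \<alpha>" and "\<alpha> < 1" and "0 < h" and "1 \<le> n"
    and "\<forall>k<n. chi k \<in> Linf_binary \<Lambda>"
    and "threshold_scheme_states \<Lambda> \<alpha> h n chi"
  shows "(\<exists>w. helmholtz_weak_solution \<Lambda> (helmholtz_coeff \<alpha> h) (L1_history \<alpha> chi (n - 1)) w) \<and>
    (\<forall>w. helmholtz_weak_solution \<Lambda> (helmholtz_coeff \<alpha> h) (L1_history \<alpha> chi (n - 1)) w \<longrightarrow>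
       is_unique_H1_minimizer \<Lambda> (J_functional \<Lambda> \<alpha> h (L1_history \<alpha> chi (n - 1))) w)"
proof -
  have c: "0 < helmholtz_coeff \<alpha> h"
    using assms by (simp add: helmholtz_coeff_def Gamma_real_pos)
  \<comment> \<open>\<open>1 \<le> n\<close> turns the bound \<open>k \<le> n - 1\<close> into
    \<open>k < n\<close>, the range in which the states are known to be binary.\<close>
  have f: "L1_history \<alpha> chi (n - 1) \<in> L2_torus \<Lambda>"
    using assms(5,6) Linf_binary_subset_L2 by (intro L1_history_L2) fastforce
  show ?thesis
    using helmholtz_weak_solution_exists[OF assms(1) c f]
      helmholtz_weak_solution_unique_minimizer[OF assms(1) c f] by blast
qed

end
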